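(* There exists a universal constant $c>0$ such that the following holds. Let $q$ be a prime power and let $f\colon\mathbb{F}_q^n\to\mathbb{F}_q$ be a polynomial of degree $d$. Then there exists a partition of $\mathbb{F}_q^n$ into affine subspaces (not necessarily shifts of the same subspace), each of dimension at least $c\cdot n^{1/(d-1)!}$, such that $f$ is constant on each part.
   Context: The degree of a function $f\colon\mathbb{F}_q^n\to\mathbb{F}_q$ is the total degree of the unique polynomial over $\mathbb{F}_q$ with all individual degrees at most $q-1$ that agrees with $f$ on $\mathbb{F}_q^n$.
   Formalization: The dimension bound is the integer part of c·n^{1/(d-1)!}, since the literal bound fails (n = d = 1, f(x) = x is constant only on points); d ≥ 1 is assumed so that (d-1)! makes sense, and each F_q is represented by an isomorphic field whose elements are natural numbers. *)

theory Defs
  imports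
    Complex_Main
    "HOL-Library.Disjoint_Sets"
    "HOL-Algebra.Indexed_Polynomials"
    "Jordan_Normal_Form.Missing_VectorSpace"
begin

text \<open>
  The vector space of \<open>n\<close>-tuples over \<open>F\<close>: tuples are the extensional functions on \<open>{..<n}\<close>,
  with pointwise operations.
\<close>

abbreviation tuple_space ::
    "('a, 'b) ring_scheme \<Rightarrow> nat \<Rightarrow> ('a, nat \<Rightarrow> 'a) module" where
  "tuple_space F n \<equiv> ring.func_space F {..<n}"

definition affine_subspace ::
    "('a, 'b) ring_scheme \<Rightarrow> nat \<Rightarrow> nat \<Rightarrow> (nat \<Rightarrow> 'a) set \<Rightarrow> bool" where
  "affine_subspace F n k A \<longleftrightarrow>
     (\<exists>v W. v \<in> carrier (tuple_space F n) \<and> subspace F W (tuple_space F n) \<and>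
        vectorspace.dim F (tuple_space F n\<lparr>carrier := W\<rparr>) = k \<and>
        A = v <+\<^bsub>tuple_space F n\<^esub> W)"

text \<open>
  An indexed polynomial maps each monomial, a multiset \<open>m\<close> of indices of variables, to its
  coefficient: \<open>count m i\<close> is the exponent of variable \<open>i\<close> and \<open>size m\<close> is the total degree of \<open>m\<close>.
\<close>

definition mpoly_support :: "('a, 'b) ring_scheme \<Rightarrow> (nat multiset \<Rightarrow> 'a) \<Rightarrow> nat multiset set" where
  "mpoly_support F p = {m. p m \<noteq> \<zero>\<^bsub>F\<^esub>}"

definition mpoly_eval ::
    "('a, 'b) ring_scheme \<Rightarrow> nat \<Rightarrow> (nat multiset \<Rightarrow> 'a) \<Rightarrow> (nat \<Rightarrow> 'a) \<Rightarrow> 'a" where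
  "mpoly_eval F n p x =
     (\<Oplus>\<^bsub>F\<^esub>m\<in>mpoly_support F p. p m \<otimes>\<^bsub>F\<^esub> (\<Otimes>\<^bsub>F\<^esub>i\<in>{..<n}. x i [^]\<^bsub>F\<^esub> count m i))"

text \<open>The zero polynomial gets total degree 0.\<close>

definition mpoly_degree :: "('a, 'b) ring_scheme \<Rightarrow> (nat multiset \<Rightarrow> 'a) \<Rightarrow> nat" where
  "mpoly_degree F p = Max (insert 0 (size ` mpoly_support F p))"

definition reduced_mpoly ::
    "('a, 'b) ring_scheme \<Rightarrow> nat \<Rightarrow> (nat multiset \<Rightarrow> 'a) \<Rightarrow> bool" where
  "reduced_mpoly F n p \<longleftrightarrow>
     p \<in> ring.indexed_pset F {..<n} (carrier F) \<and>
     (\<forall>m\<in>mpoly_support F p. \<forall>i<n. count m i \<le> order F - 1)"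

text \<open>
  Over a finite field every function on tuples is given by exactly one reduced polynomial, so
  \<open>d\<close> below is determined by \<open>f\<close>.
\<close>

definition has_degree ::
    "('a, 'b) ring_scheme \<Rightarrow> nat \<Rightarrow> ((nat \<Rightarrow> 'a) \<Rightarrow> 'a) \<Rightarrow> nat \<Rightarrow> bool" where
  "has_degree F n f d \<longleftrightarrow>
     (\<exists>p. reduced_mpoly F n p \<and>
        (\<forall>x\<in>carrier (tuple_space F n). f x = mpoly_eval F n p x) \<and> mpoly_degree F p = d)"

text \<open>
  Two conventions for statements about partitions into affine subspaces with a constant that is
  uniform in the field, the number of variables and the degree.  First, fields are taken with
  carrier in \<^typ>\<open>nat\<close>: every finite field is isomorphic to such a field, and one existentially
  quantified constant can then serve all finite fields (with a field given by a type variable,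
  the constant could depend on the type).  Second, a lower bound \<open>c \<cdot> n powr e\<close> with \<open>c > 0\<close> on
  a dimension is read with its integer part.  Where \<open>c \<cdot> n powr e \<ge> 1\<close>, rounding only affects
  the constant.  Where \<open>0 < c \<cdot> n powr e < 1\<close>, the unrounded bound would exclude single points,
  which cannot be avoided: the coordinate function on a one-dimensional space is constant on
  single points only.
\<close>

end

theory Submission
  imports Defs
begin

text \<open>
  If \<open>f\<close> of degree \<open>d + 1\<close> is constant on a linear subspace \<open>U\<close>, then on every coset of \<open>U\<close>
  it has degree at most \<open>d\<close>, because there it differs from a constant by a discrete derivative.
  Iterating this on the cosets leads down to degree \<open>0\<close>, so it suffices to find, in dimension \<open>m\<close>,
  a subspace of dimension of order \<open>m\<close> to the power \<open>1 / d\<close> (or \<open>m - 1\<close> if \<open>d = 0\<close>) on which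
  \<open>f\<close> is constant.
  Such a subspace is built one vector at a time.  That \<open>x\<close> extends a \<open>k\<close>-dimensional \<open>U\<close> is a
  polynomial system in \<open>x\<close> which \<open>x = 0\<close> satisfies; its equations, one for each monomial in the
  coordinates of \<open>U\<close> and the multiplier of \<open>x\<close>, have total degree
  \<open>(k + d + 2) choose (k + 2)\<close>.  As long as this is below \<open>m - k\<close>, the argument of Chevalley and
  Warning on a complement of \<open>U\<close> yields a nonzero solution.
\<close>

subsection \<open>Polynomial functions on a finite vector space\<close>

locale finite_vectorspace = vectorspace K V for K (structure) and V (structure) +
  assumes finite_K: "finite (carrier K)" and finite_V: "finite (carrier V)"
begin

definition functional :: "('c \<Rightarrow> 'a) \<Rightarrow> bool" where
  "functional l \<longleftrightarrow> l \<in> carrier V \<rightarrow> carrier K \<and>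
     (\<forall>u\<in>carrier V. \<forall>v\<in>carrier V. l (u \<oplus>\<^bsub>V\<^esub> v) = l u \<oplus> l v) \<and>
     (\<forall>a\<in>carrier K. \<forall>u\<in>carrier V. l (a \<odot>\<^bsub>V\<^esub> u) = a \<otimes> l u)"

text \<open>
  Generating by linear functionals rather than by coordinates keeps the notion independent of a
  basis, so that restrictions to subspaces need no change of variables.
\<close>

inductive poly_fun :: "nat \<Rightarrow> ('c \<Rightarrow> 'a) \<Rightarrow> bool" where
  const: "c \<in> carrier K \<Longrightarrow> poly_fun d (\<lambda>_. c)"
| mult: "functional l \<Longrightarrow> poly_fun d g \<Longrightarrow> poly_fun (Suc d) (\<lambda>x. l x \<otimes> g x)"
| add: "poly_fun d g \<Longrightarrow> poly_fun d h \<Longrightarrow> poly_fun d (\<lambda>x. g x \<oplus> h x)"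
| ext: "poly_fun d g \<Longrightarrow> (\<And>x. x \<in> carrier V \<Longrightarrow> h x = g x) \<Longrightarrow> poly_fun d h"

lemma functional_closed [simp]: "functional l \<Longrightarrow> u \<in> carrier V \<Longrightarrow> l u \<in> carrier K"
  by (auto simp: functional_def)

lemma poly_fun_closed: "poly_fun d g \<Longrightarrow> x \<in> carrier V \<Longrightarrow> g x \<in> carrier K"
  by (induction rule: poly_fun.induct) auto

lemma poly_fun_mono: "poly_fun d g \<Longrightarrow> d \<le> e \<Longrightarrow> poly_fun e g"
proof (induction arbitrary: e rule: poly_fun.induct)
  case (mult l d g)
  then obtain e' where "e = Suc e'" "d \<le> e'" by (cases e) auto
  with mult show ?case by (auto intro: poly_fun.mult)
qed (auto intro: poly_fun.intros)

lemma poly_fun_mult: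
  assumes "poly_fun d g" "poly_fun e h"
  shows "poly_fun (d + e) (\<lambda>x. g x \<otimes> h x)"
  using assms(1)
proof (induction rule: poly_fun.induct)
  case (const c d)
  have "poly_fun (d + e) (\<lambda>x. c \<otimes> h x)"
    using assms(2)
  proof (induction rule: poly_fun.induct)
    case (mult l e h)
    have "poly_fun (Suc (d + e)) (\<lambda>x. l x \<otimes> (c \<otimes> h x))"
      using mult by (auto intro: poly_fun.mult)
    then show ?case
      by (simp, elim poly_fun.ext) (use const mult in \<open>simp add: poly_fun_closed m_lcomm\<close>)
  next
    case (add e g h)
    then show ?case
      by (intro poly_fun.ext[OF poly_fun.add[OF add.IH]])
        (use const add in \<open>simp add: poly_fun_closed r_distr\<close>)
  next
    case (ext e g h)
    then show ?case by (intro poly_fun.ext[OF ext.IH]) auto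
  qed (use const in \<open>auto intro: poly_fun.const\<close>)
  then show ?case .
next
  case (mult l d g)
  have "poly_fun (Suc (d + e)) (\<lambda>x. l x \<otimes> (g x \<otimes> h x))"
    using mult by (auto intro: poly_fun.mult)
  then show ?case
    by (simp, elim poly_fun.ext) (use mult assms(2) in \<open>simp add: poly_fun_closed m_assoc\<close>)
next
  case (add d f g)
  then show ?case
    by (intro poly_fun.ext[OF poly_fun.add[OF add.IH]])
      (use assms(2) add in \<open>simp add: poly_fun_closed l_distr\<close>)
next
  case (ext d g h)
  then show ?case by (intro poly_fun.ext[OF ext.IH]) auto
qed

lemma poly_fun_smult: "c \<in> carrier K \<Longrightarrow> poly_fun d g \<Longrightarrow> poly_fun d (\<lambda>x. c \<otimes> g x)"
  using poly_fun_mult[OF poly_fun.const[of c 0]] by simp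

lemma poly_fun_minus:
  assumes "poly_fun d g" "poly_fun d h"
  shows "poly_fun d (\<lambda>x. g x \<ominus> h x)"
  by (rule poly_fun.ext[OF poly_fun.add[OF assms(1) poly_fun_smult[of "\<ominus> \<one>", OF _ assms(2)]]])
    (use assms in \<open>simp_all add: poly_fun_closed a_minus_def l_minus\<close>)

lemma poly_fun_pow: "poly_fun d g \<Longrightarrow> poly_fun (d * n) (\<lambda>x. g x [^] (n::nat))"
proof (induction n)
  case (Suc n)
  then show ?case
    using poly_fun_mult[OF Suc.IH, of d g] by (simp add: add.commute)
qed (auto intro: poly_fun.const)

lemma poly_fun_finsum:
  assumes "finite I" "\<And>i. i \<in> I \<Longrightarrow> poly_fun d (g i)"
  shows "poly_fun d (\<lambda>x. \<Oplus>i\<in>I. g i x)"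
  using assms
proof (induction rule: finite_induct)
  case empty
  then show ?case by (simp add: poly_fun.const)
next
  case (insert i I)
  have "poly_fun d (\<lambda>x. g i x \<oplus> (\<Oplus>i\<in>I. g i x))"
    using insert by (auto intro: poly_fun.add)
  then show ?case
    proof (rule poly_fun.ext)
    fix x assume x: "x \<in> carrier V"
    have "g j x \<in> carrier K" if "j \<in> insert i I" for j
      using insert.prems[OF that] x by (rule poly_fun_closed)
    then show "(\<Oplus>i\<in>insert i I. g i x) = g i x \<oplus> (\<Oplus>i\<in>I. g i x)"
      using insert.hyps by (intro R.finsum_insert) auto
  qed
qed

lemma poly_fun_finprod:
  assumes "finite I" "\<And>i. i \<in> I \<Longrightarrow> poly_fun (e i) (g i)"
  shows "poly_fun (\<Sum>i\<in>I. e i) (\<lambda>x. \<Otimes>i\<in>I. g i x)"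
  using assms
proof (induction rule: finite_induct)
  case empty
  then show ?case by (simp add: poly_fun.const)
next
  case (insert i I)
  have "poly_fun (e i + (\<Sum>i\<in>I. e i)) (\<lambda>x. g i x \<otimes> (\<Otimes>i\<in>I. g i x))"
    using insert by (intro poly_fun_mult) auto
  then have "poly_fun (\<Sum>i\<in>insert i I. e i) (\<lambda>x. g i x \<otimes> (\<Otimes>i\<in>I. g i x))"
    using insert.hyps by simp
  then show ?case
  proof (rule poly_fun.ext)
    fix x assume x: "x \<in> carrier V"
    have "g j x \<in> carrier K" if "j \<in> insert i I" for j
      using insert.prems[OF that] x by (rule poly_fun_closed)
    then show "(\<Otimes>i\<in>insert i I. g i x) = g i x \<otimes> (\<Otimes>i\<in>I. g i x)"
      using insert.hyps by (intro R.finprod_insert) auto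
  qed
qed

lemma functional_zero: "functional l \<Longrightarrow> l \<zero>\<^bsub>V\<^esub> = \<zero>"
proof -
  assume l: "functional l"
  have "l (\<zero> \<odot>\<^bsub>V\<^esub> \<zero>\<^bsub>V\<^esub>) = \<zero> \<otimes> l \<zero>\<^bsub>V\<^esub>"
    using l unfolding functional_def by blast
  then show ?thesis using l by simp
qed

text \<open>In degree 0 the rule \<open>mult\<close> cannot occur, so only constants and their sums
  remain. The descent in degree ends here.\<close>

lemma poly_fun_zero_const: "poly_fun d g \<Longrightarrow> d = 0 \<Longrightarrow> x \<in> carrier V \<Longrightarrow> y \<in> carrier V \<Longrightarrow> g x = g y"
proof (induction rule: poly_fun.induct)
  case (add d g h)
  then show ?case by metis
next
  case (ext d g h)
  then show ?case by metis
qed auto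

section \<open>Expansions of polynomial functions in powers of a scalar\<close>

lemma finsum_pow_head:
  assumes "b \<in> carrier K" "c \<in> carrier K"
  shows "(\<Oplus>j\<in>{..(d::nat)}. b [^] j \<otimes> (if j = 0 then c else \<zero>)) = c"
proof -
  have "(\<Oplus>j\<in>{..d}. b [^] j \<otimes> (if j = 0 then c else \<zero>)) = (\<Oplus>j\<in>{..d}. if 0 = j then c else \<zero>)"
    using assms by (intro R.finsum_cong') auto
  also have "\<dots> = c"
    using assms by (intro R.add.finprod_singleton) auto
  finally show ?thesis .
qed

text \<open>A functional splits as \<open>l z \<oplus> b \<otimes> l y\<close>, so each factor
  either keeps the power of \<open>b\<close> and contributes one degree in \<open>z\<close>, or
  raises that power and contributes none. Hence the coefficient of the \<open>j\<close>-th power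
  loses \<open>j\<close> degrees.\<close>

lemma poly_fun_expand_along:
  assumes "poly_fun d g" "y \<in> carrier V"
  shows "\<exists>G. (\<forall>j\<le>d. poly_fun (d - j) (G j)) \<and>
    (\<forall>z\<in>carrier V. \<forall>b\<in>carrier K.
       g (z \<oplus>\<^bsub>V\<^esub> b \<odot>\<^bsub>V\<^esub> y) = (\<Oplus>j\<in>{..d}. b [^] j \<otimes> G j z))"
  using assms(1)
proof (induction rule: poly_fun.induct)
  case (const c d)
  show ?case
    by (rule exI[of _ "\<lambda>j _. if j = 0 then c else \<zero>"])
      (use const in \<open>simp add: finsum_pow_head poly_fun.const\<close>)
next
  case (mult l d g)
  from mult.IH obtain G where G: "\<And>j. j \<le> d \<Longrightarrow> poly_fun (d - j) (G j)"
    and g: "\<And>z b. z \<in> carrier V \<Longrightarrow> b \<in> carrier K \<Longrightarrow>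
       g (z \<oplus>\<^bsub>V\<^esub> b \<odot>\<^bsub>V\<^esub> y) = (\<Oplus>j\<in>{..d}. b [^] j \<otimes> G j z)" by blast
  have Gc: "G j z \<in> carrier K" if "j \<le> d" "z \<in> carrier V" for j z
    using that G poly_fun_closed by blast
  have ly: "l y \<in> carrier K" using mult assms by simp
  \<comment> \<open>\<open>A\<close> collects the contributions of \<open>l z\<close>, and
    \<open>B\<close> those of \<open>b \<otimes> l y\<close>, which shift the index by one. The
    index that each of them lacks, \<open>Suc d\<close> and \<open>0\<close> respectively, gets
    zero.\<close>
  define A where "A j z = (if j \<le> d then l z \<otimes> G j z else \<zero>)" for j z
  define B where "B j z = (if j = 0 then \<zero> else l y \<otimes> G (j - 1) z)" for j z
  have A: "poly_fun (Suc d - j) (A j)" if "j \<le> Suc d" for j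
    using that G[of j] mult unfolding A_def
    by (cases "j \<le> d") (auto simp: Suc_diff_le intro: poly_fun.mult poly_fun.const)
  have B: "poly_fun (Suc d - j) (B j)" if "j \<le> Suc d" for j
    using that ly G[of "j - 1"] unfolding B_def
    by (cases j) (auto intro: poly_fun_smult poly_fun.const)
  have Ac: "A j z \<in> carrier K" and Bc: "B j z \<in> carrier K" if "j \<le> Suc d" "z \<in> carrier V" for j z
    using A[OF that(1)] B[OF that(1)] that(2) poly_fun_closed by blast+
  show ?case
  proof (intro exI[of _ "\<lambda>j z. A j z \<oplus> B j z"] conjI ballI allI impI)
    fix j assume "j \<le> Suc d"
    then show "poly_fun (Suc d - j) (\<lambda>z. A j z \<oplus> B j z)"
      using A B by (intro poly_fun.add) auto
  next
    fix z b assume z: "z \<in> carrier V" and b: "b \<in> carrier K"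
    define S where "S = (\<Oplus>j\<in>{..d}. b [^] j \<otimes> G j z)"
    have S: "S \<in> carrier K" unfolding S_def using z b Gc by (intro R.finsum_closed) auto
    have "(\<Oplus>j\<in>{..Suc d}. b [^] j \<otimes> (A j z \<oplus> B j z)) =
       (\<Oplus>j\<in>{..Suc d}. b [^] j \<otimes> A j z \<oplus> b [^] j \<otimes> B j z)"
      using z b Ac Bc by (intro R.finsum_cong') (auto simp: r_distr)
    also have "\<dots> = (\<Oplus>j\<in>{..Suc d}. b [^] j \<otimes> A j z) \<oplus> (\<Oplus>j\<in>{..Suc d}. b [^] j \<otimes> B j z)"
      using z b Ac Bc by (intro R.finsum_addf) auto
    also have "(\<Oplus>j\<in>{..Suc d}. b [^] j \<otimes> A j z) = (\<Oplus>j\<in>{..d}. b [^] j \<otimes> A j z)"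
      proof -
      have "(\<Oplus>j\<in>{..d}. b [^] j \<otimes> A j z) \<in> carrier K"
        using z b Ac by (intro R.finsum_closed) auto
      moreover have "b [^] Suc d \<otimes> A (Suc d) z = \<zero>"
        using b by (simp add: A_def)
      ultimately show ?thesis
        using z b Ac by (subst R.finsum_Suc) auto
    qed
    also have "\<dots> = (\<Oplus>j\<in>{..d}. l z \<otimes> (b [^] j \<otimes> G j z))"
      using z b Gc mult by (intro R.finsum_cong') (auto simp: A_def m_lcomm)
    also have "\<dots> = l z \<otimes> S"
      unfolding S_def using z b Gc mult by (intro R.finsum_rdistr[symmetric]) auto
    also have "(\<Oplus>j\<in>{..Suc d}. b [^] j \<otimes> B j z) = (\<Oplus>j\<in>{..d}. b [^] Suc j \<otimes> B (Suc j) z)"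
    proof -
      have "(\<Oplus>j\<in>{..d}. b [^] Suc j \<otimes> B (Suc j) z) \<in> carrier K"
        using z b Bc by (intro R.finsum_closed) auto
      moreover have "b [^] (0::nat) \<otimes> B 0 z = \<zero>"
        by (simp add: B_def)
      ultimately show ?thesis
        using z b Bc by (subst R.finsum_Suc2) (auto simp del: nat_pow_Suc)
    qed
    also have "\<dots> = (\<Oplus>j\<in>{..d}. (b \<otimes> l y) \<otimes> (b [^] j \<otimes> G j z))"
      using z b Gc ly by (intro R.finsum_cong') (auto simp: B_def m_ac)
    also have "\<dots> = (b \<otimes> l y) \<otimes> S"
      unfolding S_def using z b Gc ly by (intro R.finsum_rdistr[symmetric]) auto
    also have "l z \<otimes> S \<oplus> (b \<otimes> l y) \<otimes> S = (l z \<oplus> b \<otimes> l y) \<otimes> S"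
      using z b S mult ly by (simp add: l_distr)
    also have "l z \<oplus> b \<otimes> l y = l (z \<oplus>\<^bsub>V\<^esub> b \<odot>\<^bsub>V\<^esub> y)"
      using mult(1) z b assms unfolding functional_def by simp
    finally show "l (z \<oplus>\<^bsub>V\<^esub> b \<odot>\<^bsub>V\<^esub> y) \<otimes> g (z \<oplus>\<^bsub>V\<^esub> b \<odot>\<^bsub>V\<^esub> y) =
        (\<Oplus>j\<in>{..Suc d}. b [^] j \<otimes> (A j z \<oplus> B j z))"
      using g[OF z b] S_def by simp
  qed
next
  case (add d g h)
  from add.IH obtain G H where G: "\<And>j. j \<le> d \<Longrightarrow> poly_fun (d - j) (G j)"
    and g: "\<And>z b. z \<in> carrier V \<Longrightarrow> b \<in> carrier K \<Longrightarrow>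
       g (z \<oplus>\<^bsub>V\<^esub> b \<odot>\<^bsub>V\<^esub> y) = (\<Oplus>j\<in>{..d}. b [^] j \<otimes> G j z)"
    and H: "\<And>j. j \<le> d \<Longrightarrow> poly_fun (d - j) (H j)"
    and h: "\<And>z b. z \<in> carrier V \<Longrightarrow> b \<in> carrier K \<Longrightarrow>
       h (z \<oplus>\<^bsub>V\<^esub> b \<odot>\<^bsub>V\<^esub> y) = (\<Oplus>j\<in>{..d}. b [^] j \<otimes> H j z)" by blast
  have Gc: "G j z \<in> carrier K" "H j z \<in> carrier K" if "j \<le> d" "z \<in> carrier V" for j z
    using that G H poly_fun_closed by blast+
  show ?case
  proof (intro exI[of _ "\<lambda>j z. G j z \<oplus> H j z"] conjI ballI allI impI)
    fix z b assume z: "z \<in> carrier V" and b: "b \<in> carrier K"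
    have "(\<Oplus>j\<in>{..d}. b [^] j \<otimes> (G j z \<oplus> H j z)) =
       (\<Oplus>j\<in>{..d}. b [^] j \<otimes> G j z \<oplus> b [^] j \<otimes> H j z)"
      using z b Gc by (intro R.finsum_cong') (auto simp: r_distr)
    also have "\<dots> = (\<Oplus>j\<in>{..d}. b [^] j \<otimes> G j z) \<oplus> (\<Oplus>j\<in>{..d}. b [^] j \<otimes> H j z)"
      using z b Gc by (intro R.finsum_addf) auto
    finally show "g (z \<oplus>\<^bsub>V\<^esub> b \<odot>\<^bsub>V\<^esub> y) \<oplus> h (z \<oplus>\<^bsub>V\<^esub> b \<odot>\<^bsub>V\<^esub> y) =
        (\<Oplus>j\<in>{..d}. b [^] j \<otimes> (G j z \<oplus> H j z))"
      using g[OF z b] h[OF z b] by simp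
  qed (use G H in \<open>auto intro: poly_fun.add\<close>)
next
  case (ext d g h)
  have "h (z \<oplus>\<^bsub>V\<^esub> b \<odot>\<^bsub>V\<^esub> y) = g (z \<oplus>\<^bsub>V\<^esub> b \<odot>\<^bsub>V\<^esub> y)" if "z \<in> carrier V" "b \<in> carrier K" for z b
    using that assms(2) by (intro ext.hyps) auto
  then show ?case using ext.IH by simp
qed

text \<open>Scaling the whole argument pulls one \<open>b\<close> out of every functional, so
  coefficient \<open>j\<close> is built from products of \<open>j\<close> functionals. For
  \<open>j > 0\<close> it therefore vanishes at the zero vector, which makes that vector a solution
  of the equations derived from it.\<close>

lemma poly_fun_expand_homogeneous:
  assumes "poly_fun d g"
  shows "\<exists>H. (\<forall>j\<le>d. poly_fun j (H j) \<and> (j > 0 \<longrightarrow> H j \<zero>\<^bsub>V\<^esub> = \<zero>)) \<and>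
    (\<forall>x\<in>carrier V. \<forall>b\<in>carrier K. g (b \<odot>\<^bsub>V\<^esub> x) = (\<Oplus>j\<in>{..d}. b [^] j \<otimes> H j x))"
  using assms
proof (induction rule: poly_fun.induct)
  case (const c d)
  show ?case
    by (rule exI[of _ "\<lambda>j _. if j = 0 then c else \<zero>"])
      (use const in \<open>simp add: finsum_pow_head poly_fun.const\<close>)
next
  case (mult l d g)
  from mult.IH obtain H where H: "\<And>j. j \<le> d \<Longrightarrow> poly_fun j (H j)"
    and g: "\<And>x b. x \<in> carrier V \<Longrightarrow> b \<in> carrier K \<Longrightarrow>
       g (b \<odot>\<^bsub>V\<^esub> x) = (\<Oplus>j\<in>{..d}. b [^] j \<otimes> H j x)" by blast
  have Hc: "H j x \<in> carrier K" if "j \<le> d" "x \<in> carrier V" for j x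
    using that H poly_fun_closed by blast
  define A where "A j x = (if j = 0 then \<zero> else l x \<otimes> H (j - 1) x)" for j x
  have A: "poly_fun j (A j)" if "j \<le> Suc d" for j
    using that mult(1) H[of "j - 1"] unfolding A_def
    by (cases j) (auto intro: poly_fun.mult poly_fun.const)
  have Ac: "A j x \<in> carrier K" if "j \<le> Suc d" "x \<in> carrier V" for j x
    using A[OF that(1)] that(2) poly_fun_closed by blast
  show ?case
  proof (intro exI[of _ A] conjI ballI allI impI)
    fix x b assume x: "x \<in> carrier V" and b: "b \<in> carrier K"
    have "(\<Oplus>j\<in>{..Suc d}. b [^] j \<otimes> A j x) = (\<Oplus>j\<in>{..d}. b [^] Suc j \<otimes> A (Suc j) x)"
      proof -
      have "(\<Oplus>j\<in>{..d}. b [^] Suc j \<otimes> A (Suc j) x) \<in> carrier K"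
        using x b Ac by (intro R.finsum_closed) auto
      moreover have "b [^] (0::nat) \<otimes> A 0 x = \<zero>"
        by (simp add: A_def)
      ultimately show ?thesis
        using x b Ac by (subst R.finsum_Suc2) (auto simp del: nat_pow_Suc)
    qed
    also have "\<dots> = (\<Oplus>j\<in>{..d}. (b \<otimes> l x) \<otimes> (b [^] j \<otimes> H j x))"
      using x b Hc mult(1) by (intro R.finsum_cong') (auto simp: A_def m_ac)
    also have "\<dots> = (b \<otimes> l x) \<otimes> (\<Oplus>j\<in>{..d}. b [^] j \<otimes> H j x)"
      using x b Hc mult(1) by (intro R.finsum_rdistr[symmetric]) auto
    also have "b \<otimes> l x = l (b \<odot>\<^bsub>V\<^esub> x)"
      using mult(1) x b unfolding functional_def by simp
    finally show "l (b \<odot>\<^bsub>V\<^esub> x) \<otimes> g (b \<odot>\<^bsub>V\<^esub> x) = (\<Oplus>j\<in>{..Suc d}. b [^] j \<otimes> A j x)"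
      using g[OF x b] by simp
  next
    fix j :: nat assume "0 < j" "j \<le> Suc d"
    then show "A j \<zero>\<^bsub>V\<^esub> = \<zero>"
      using mult(1) Hc[of "j - 1" "\<zero>\<^bsub>V\<^esub>"] by (auto simp: A_def functional_zero)
  qed (use A in auto)
next
  case (add d g h)
  from add.IH(1) obtain G where G: "\<forall>j\<le>d. poly_fun j (G j) \<and> (j > 0 \<longrightarrow> G j \<zero>\<^bsub>V\<^esub> = \<zero>)"
    and g: "\<forall>x\<in>carrier V. \<forall>b\<in>carrier K. g (b \<odot>\<^bsub>V\<^esub> x) = (\<Oplus>j\<in>{..d}. b [^] j \<otimes> G j x)"
    by (elim exE conjE)
  from add.IH(2) obtain H where H: "\<forall>j\<le>d. poly_fun j (H j) \<and> (j > 0 \<longrightarrow> H j \<zero>\<^bsub>V\<^esub> = \<zero>)"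
    and h: "\<forall>x\<in>carrier V. \<forall>b\<in>carrier K. h (b \<odot>\<^bsub>V\<^esub> x) = (\<Oplus>j\<in>{..d}. b [^] j \<otimes> H j x)"
    by (elim exE conjE)
  have Gc: "G j x \<in> carrier K" "H j x \<in> carrier K" if "j \<le> d" "x \<in> carrier V" for j x
    using that G H poly_fun_closed by blast+
  show ?case
  proof (intro exI[of _ "\<lambda>j x. G j x \<oplus> H j x"] conjI ballI allI impI)
    fix x b assume x: "x \<in> carrier V" and b: "b \<in> carrier K"
    have "(\<Oplus>j\<in>{..d}. b [^] j \<otimes> (G j x \<oplus> H j x)) =
       (\<Oplus>j\<in>{..d}. b [^] j \<otimes> G j x \<oplus> b [^] j \<otimes> H j x)"
      using x b Gc by (intro R.finsum_cong') (auto simp: r_distr)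
    also have "\<dots> = (\<Oplus>j\<in>{..d}. b [^] j \<otimes> G j x) \<oplus> (\<Oplus>j\<in>{..d}. b [^] j \<otimes> H j x)"
      using x b Gc by (intro R.finsum_addf) auto
    finally show "g (b \<odot>\<^bsub>V\<^esub> x) \<oplus> h (b \<odot>\<^bsub>V\<^esub> x) = (\<Oplus>j\<in>{..d}. b [^] j \<otimes> (G j x \<oplus> H j x))"
      using g h x b by simp
  qed (use G H in \<open>auto intro: poly_fun.add\<close>)
next
  case (ext d g h)
  have "h (b \<odot>\<^bsub>V\<^esub> x) = g (b \<odot>\<^bsub>V\<^esub> x)" if "x \<in> carrier V" "b \<in> carrier K" for x b
    using that by (intro ext.hyps) auto
  then show ?case using ext.IH by simp
qed

text \<open>In the expansion along \<open>v\<close>, the value \<open>b = \<zero>\<close> identifies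
  the coefficient \<open>G 0\<close> with \<open>g\<close>, the value \<open>b = \<one>\<close>
  gives the shifted function, and all coefficients other than \<open>G 0\<close> have degree at most
  \<open>d\<close>.\<close>

lemma poly_fun_difference:
  assumes "poly_fun (Suc d) g" "v \<in> carrier V"
  shows "poly_fun d (\<lambda>x. g (x \<oplus>\<^bsub>V\<^esub> v) \<ominus> g x)"
proof -
  obtain G where G: "\<And>j. j \<le> Suc d \<Longrightarrow> poly_fun (Suc d - j) (G j)"
    and g: "\<And>z b. z \<in> carrier V \<Longrightarrow> b \<in> carrier K \<Longrightarrow>
       g (z \<oplus>\<^bsub>V\<^esub> b \<odot>\<^bsub>V\<^esub> v) = (\<Oplus>j\<in>{..Suc d}. b [^] j \<otimes> G j z)"
    using poly_fun_expand_along[OF assms] by blast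
  have Gc: "G j z \<in> carrier K" if "j \<le> Suc d" "z \<in> carrier V" for j z
    using that G poly_fun_closed by blast
  have "poly_fun d (\<lambda>x. \<Oplus>j\<in>{..d}. G (Suc j) x)"
    by (intro poly_fun_finsum poly_fun_mono[OF G]) auto
  moreover have "g (x \<oplus>\<^bsub>V\<^esub> v) \<ominus> g x = (\<Oplus>j\<in>{..d}. G (Suc j) x)" if x: "x \<in> carrier V" for x
  proof -
    have D: "(\<Oplus>j\<in>{..d}. G (Suc j) x) \<in> carrier K" "G 0 x \<in> carrier K"
      using x Gc by auto
    have "g (x \<oplus>\<^bsub>V\<^esub> v) = (\<Oplus>j\<in>{..Suc d}. G j x)"
      using g[OF x, of \<one>] assms x Gc by (auto intro!: R.finsum_cong')
    also have "\<dots> = (\<Oplus>j\<in>{..d}. G (Suc j) x) \<oplus> G 0 x"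
      using x Gc by (intro R.finsum_Suc2) auto
    finally have 1: "g (x \<oplus>\<^bsub>V\<^esub> v) = (\<Oplus>j\<in>{..d}. G (Suc j) x) \<oplus> G 0 x" .
    have "g x = (\<Oplus>j\<in>{..Suc d}. \<zero> [^] j \<otimes> G j x)"
      using g[OF x, of \<zero>] assms x by simp
    also have "\<dots> = (\<Oplus>j\<in>{..d}. \<zero> [^] Suc j \<otimes> G (Suc j) x) \<oplus> \<zero> [^] (0::nat) \<otimes> G 0 x"
      using x Gc by (intro R.finsum_Suc2) auto
    also have "(\<Oplus>j\<in>{..d}. \<zero> [^] Suc j \<otimes> G (Suc j) x) = \<zero>"
      using x Gc by (intro R.add.finprod_one_eqI) auto
    finally have "g x = G 0 x" using D by simp
    then show ?thesis using 1 D by (simp add: a_minus_def R.a_assoc R.r_neg)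
  qed
  ultimately show ?thesis by (rule poly_fun.ext)
qed

subsection \<open>Sums over subspaces\<close>

lemma finsum_swap:
  assumes "finite A" "finite B" "\<And>i j. i \<in> A \<Longrightarrow> j \<in> B \<Longrightarrow> f i j \<in> carrier K"
  shows "(\<Oplus>i\<in>A. \<Oplus>j\<in>B. f i j) = (\<Oplus>j\<in>B. \<Oplus>i\<in>A. f i j)"
  using assms(1,3)
proof (induction rule: finite_induct)
  case empty
  then show ?case by simp
next
  case (insert a A)
  have "(\<Oplus>i\<in>insert a A. \<Oplus>j\<in>B. f i j) = (\<Oplus>j\<in>B. f a j) \<oplus> (\<Oplus>i\<in>A. \<Oplus>j\<in>B. f i j)"
    using insert by (intro R.finsum_insert) auto
  also have "(\<Oplus>i\<in>A. \<Oplus>j\<in>B. f i j) = (\<Oplus>j\<in>B. \<Oplus>i\<in>A. f i j)"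
    using insert by simp
  also have "(\<Oplus>j\<in>B. f a j) \<oplus> (\<Oplus>j\<in>B. \<Oplus>i\<in>A. f i j) = (\<Oplus>j\<in>B. f a j \<oplus> (\<Oplus>i\<in>A. f i j))"
    using insert by (intro R.finsum_addf[symmetric]) auto
  also have "\<dots> = (\<Oplus>j\<in>B. \<Oplus>i\<in>insert a A. f i j)"
    using insert by (intro R.finsum_cong' refl R.finsum_insert[symmetric]) auto
  finally show ?case .
qed

abbreviation q :: nat where "q \<equiv> card (carrier K)"

lemma q_ge_2: "q \<ge> 2"
proof -
  have "card {\<zero>, \<one>} \<le> q"
    using finite_K by (intro card_mono) auto
  then show ?thesis by simp
qed

lemma pow_q_minus_1:
  assumes "a \<in> carrier K" "a \<noteq> \<zero>"
  shows "a [^] (q - 1) = \<one>"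
proof -
  interpret M: group "Multiplicative_Group.mult_of K" by (rule field_mult_group)
  have "a [^]\<^bsub>Multiplicative_Group.mult_of K\<^esub> order (Multiplicative_Group.mult_of K) = \<one>\<^bsub>Multiplicative_Group.mult_of K\<^esub>"
    using assms finite_K by (intro M.pow_order_eq_1) auto
  then show ?thesis
    using finite_K by (simp add: mult_of_simps order_mult_of order_def)
qed

text \<open>Permuting the field by a translation (for \<open>j = 0\<close>) or by a scaling (for
  \<open>j > 0\<close>) does not change a sum over it, and the resulting equation forces
  zero.\<close>

lemma finsum_pow_eq_zero:
  assumes "j < q - 1"
  shows "(\<Oplus>a\<in>carrier K. a [^] (j::nat)) = \<zero>"
proof -
  define S where "S = (\<Oplus>a\<in>carrier K. a [^] j)"
  have S: "S \<in> carrier K" unfolding S_def by auto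
  show ?thesis
  proof (cases "j = 0")
    case True
    \<comment> \<open>For \<open>j = 0\<close> every summand is \<open>\<one>\<close>, even at
      \<open>\<zero>\<close>. Translating the sum \<open>T\<close> of all elements by
      \<open>\<one>\<close> gives \<open>T = T \<oplus> S\<close>.\<close>
    define T where "T = (\<Oplus>a\<in>carrier K. a)"
    have T: "T \<in> carrier K" unfolding T_def by auto
    have inj: "inj_on (\<lambda>a. a \<oplus> \<one>) (carrier K)"
      by (auto simp: inj_on_def)
    have "(\<lambda>a. a \<oplus> \<one>) ` carrier K = carrier K"
      using inj by (intro card_subset_eq[OF finite_K]) (auto simp: card_image)
    then have "T = (\<Oplus>a\<in>(\<lambda>a. a \<oplus> \<one>) ` carrier K. a)"
      by (simp add: T_def)
    also have "\<dots> = (\<Oplus>a\<in>carrier K. a \<oplus> \<one>)"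
      using inj by (intro R.finsum_reindex) auto
    also have "\<dots> = T \<oplus> S"
      unfolding T_def S_def using True by (simp add: R.finsum_addf)
    finally show ?thesis using T S unfolding S_def[symmetric]
      by (metis R.r_zero R.add.l_cancel R.zero_closed)
  next
    case False
    \<comment> \<open>There are at most \<open>j\<close> roots of unity of order dividing
      \<open>j\<close>, fewer than the \<open>q - 1\<close> nonzero elements. Some nonzero
      \<open>b\<close> is left over, and \<open>S = b [^] j \<otimes> S\<close> with
      \<open>b [^] j \<noteq> \<one>\<close> gives \<open>S = \<zero>\<close>.\<close>
    have "card {x \<in> carrier K. x [^] j = \<one>} < card (carrier K - {\<zero>})"
      using num_roots_le_deg[OF finite_K False] assms finite_K by simp
    then obtain b where b: "b \<in> carrier K" "b \<noteq> \<zero>" "b [^] j \<noteq> \<one>"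
    proof -
      assume *: "card {x \<in> carrier K. x [^] j = \<one>} < card (carrier K - {\<zero>})"
      have "\<not> carrier K - {\<zero>} \<subseteq> {x \<in> carrier K. x [^] j = \<one>}"
        using * finite_K card_mono[of "{x \<in> carrier K. x [^] j = \<one>}" "carrier K - {\<zero>}"] by auto
      then show ?thesis using that by blast
    qed
    have inj: "inj_on (\<lambda>a. b \<otimes> a) (carrier K)"
      using b by (auto simp: inj_on_def m_lcancel)
    have "(\<lambda>a. b \<otimes> a) ` carrier K = carrier K"
      using inj b by (intro card_subset_eq[OF finite_K]) (auto simp: card_image)
    then have "S = (\<Oplus>a\<in>(\<lambda>a. b \<otimes> a) ` carrier K. a [^] j)"
      by (simp add: S_def)
    also have "\<dots> = (\<Oplus>a\<in>carrier K. (b \<otimes> a) [^] j)"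
      using inj b by (intro R.finsum_reindex) auto
    also have "\<dots> = (\<Oplus>a\<in>carrier K. b [^] j \<otimes> a [^] j)"
      using b by (intro R.finsum_cong') (auto simp: nat_pow_distrib)
    also have "\<dots> = b [^] j \<otimes> S"
      unfolding S_def using b finite_K by (intro R.finsum_rdistr[symmetric]) auto
    finally have "\<one> \<otimes> S = b [^] j \<otimes> S" using S by simp
    then have "S = \<zero>" using m_rcancel[of S \<one> "b [^] j"] S b by auto
    then show ?thesis by (simp add: S_def)
  qed
qed

section \<open>Subspaces built by adjoining vectors\<close>

definition adjoin :: "'c set \<Rightarrow> 'c \<Rightarrow> 'c set" where
  "adjoin U x = (\<Union>a\<in>carrier K. (\<lambda>u. u \<oplus>\<^bsub>V\<^esub> a \<odot>\<^bsub>V\<^esub> x) ` U)"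

text \<open>
  Every subspace of dimension \<open>k\<close> satisfies \<open>has_dim k\<close>, but only the subspaces obtained by
  successive adjunction are needed, and they come with an induction principle.
\<close>

inductive has_dim :: "nat \<Rightarrow> 'c set \<Rightarrow> bool" where
  zero: "has_dim 0 {\<zero>\<^bsub>V\<^esub>}"
| adjoin: "has_dim k U \<Longrightarrow> x \<in> carrier V \<Longrightarrow> x \<notin> U \<Longrightarrow> has_dim (Suc k) (adjoin U x)"

lemma adjoin_iff: "y \<in> adjoin U x \<longleftrightarrow> (\<exists>u\<in>U. \<exists>a\<in>carrier K. y = u \<oplus>\<^bsub>V\<^esub> a \<odot>\<^bsub>V\<^esub> x)"
  by (auto simp: adjoin_def)

lemma submodule_zero: "submodule K {\<zero>\<^bsub>V\<^esub>} V"
  using module_axioms by (auto simp: submodule_def)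

lemma submodule_adjoin:
  assumes "submodule K U V" and x: "x \<in> carrier V"
  shows "submodule K (adjoin U x) V"
proof -
  interpret U: submodule K U V by fact
  note sub = subsetD[OF U.subset]
  show ?thesis
  proof
    show "adjoin U x \<subseteq> carrier V"
      using x sub by (auto simp: adjoin_def)
    show "\<zero>\<^bsub>V\<^esub> \<in> adjoin U x"
      unfolding adjoin_iff using x by (intro bexI[of _ "\<zero>\<^bsub>V\<^esub>"] bexI[of _ \<zero>]) auto
  next
    fix v w assume "v \<in> adjoin U x" "w \<in> adjoin U x"
    then obtain u a u' a' where *: "u \<in> U" "a \<in> carrier K" "v = u \<oplus>\<^bsub>V\<^esub> a \<odot>\<^bsub>V\<^esub> x"
      "u' \<in> U" "a' \<in> carrier K" "w = u' \<oplus>\<^bsub>V\<^esub> a' \<odot>\<^bsub>V\<^esub> x"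
      by (auto simp: adjoin_iff)
    then show "v \<oplus>\<^bsub>V\<^esub> w \<in> adjoin U x"
      unfolding adjoin_iff using x sub
      by (intro bexI[of _ "u \<oplus>\<^bsub>V\<^esub> u'"] bexI[of _ "a \<oplus> a'"])
        (auto simp: smult_l_distr M.a_ac)
  next
    fix c v assume "c \<in> carrier K" "v \<in> adjoin U x"
    then obtain u a where *: "u \<in> U" "a \<in> carrier K" "v = u \<oplus>\<^bsub>V\<^esub> a \<odot>\<^bsub>V\<^esub> x"
      by (auto simp: adjoin_iff)
    then show "c \<odot>\<^bsub>V\<^esub> v \<in> adjoin U x"
      unfolding adjoin_iff using x sub \<open>c \<in> carrier K\<close>
      by (intro bexI[of _ "c \<odot>\<^bsub>V\<^esub> u"] bexI[of _ "c \<otimes> a"])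
        (auto simp: smult_r_distr smult_assoc1)
  qed
qed

lemma has_dim_submodule: "has_dim k U \<Longrightarrow> submodule K U V"
  by (induction rule: has_dim.induct) (auto intro: submodule_zero submodule_adjoin)

lemma has_dim_subset: "has_dim k U \<Longrightarrow> U \<subseteq> carrier V"
  using has_dim_submodule submodule.subset by blast

lemma has_dim_finite: "has_dim k U \<Longrightarrow> finite U"
  using has_dim_subset finite_V finite_subset by blast

lemma submodule_minus:
  assumes "submodule K U V" "u \<in> U"
  shows "\<ominus>\<^bsub>V\<^esub> u \<in> U"
proof -
  interpret U: submodule K U V by fact
  have "u \<in> carrier V" using assms U.subset by auto
  then have "\<ominus>\<^bsub>V\<^esub> u = (\<ominus> \<one>) \<odot>\<^bsub>V\<^esub> u" by (simp add: smult_l_minus)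
  then show ?thesis using assms(2) by auto
qed

lemma submodule_smult_iff:
  assumes "submodule K U V" "x \<in> carrier V" "a \<in> carrier K" "a \<noteq> \<zero>"
  shows "a \<odot>\<^bsub>V\<^esub> x \<in> U \<longleftrightarrow> x \<in> U"
proof -
  interpret U: submodule K U V by fact
  have "inv a \<odot>\<^bsub>V\<^esub> (a \<odot>\<^bsub>V\<^esub> x) = x" "inv a \<in> carrier K"
    using assms by (auto simp: smult_assoc1[symmetric] field_Units)
  then show ?thesis using assms(3) U.smult_closed by metis
qed

text \<open>Otherwise the multiple of \<open>x\<close> by \<open>a \<ominus> a'\<close> lies in
  \<open>U\<close>, and dividing by this nonzero scalar puts \<open>x\<close> into \<open>U\<close>.
  So \<open>adjoin U x\<close> is a disjoint union of translates of \<open>U\<close>, from which its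
  cardinality and the sums over it are computed.\<close>

lemma adjoin_coset_disjoint:
  assumes U: "submodule K U V" and x: "x \<in> carrier V" "x \<notin> U"
    and "u \<in> U" "u' \<in> U" "a \<in> carrier K" "a' \<in> carrier K"
    and eq: "u \<oplus>\<^bsub>V\<^esub> a \<odot>\<^bsub>V\<^esub> x = u' \<oplus>\<^bsub>V\<^esub> a' \<odot>\<^bsub>V\<^esub> x"
  shows "a = a'"
proof (rule ccontr)
  assume "a \<noteq> a'"
  interpret U: submodule K U V by fact
  have c: "u \<in> carrier V" "u' \<in> carrier V" using assms U.subset by auto
  have "(a \<ominus> a') \<odot>\<^bsub>V\<^esub> x = a \<odot>\<^bsub>V\<^esub> x \<oplus>\<^bsub>V\<^esub> \<ominus>\<^bsub>V\<^esub> (a' \<odot>\<^bsub>V\<^esub> x)"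
    using assms by (simp add: a_minus_def smult_l_distr smult_l_minus)
  also have "a \<odot>\<^bsub>V\<^esub> x = \<ominus>\<^bsub>V\<^esub> u \<oplus>\<^bsub>V\<^esub> (u \<oplus>\<^bsub>V\<^esub> a \<odot>\<^bsub>V\<^esub> x)"
    using c x(1) \<open>a \<in> carrier K\<close> by (simp add: M.r_neg1)
  also have "\<dots> \<oplus>\<^bsub>V\<^esub> \<ominus>\<^bsub>V\<^esub> (a' \<odot>\<^bsub>V\<^esub> x) = \<ominus>\<^bsub>V\<^esub> u \<oplus>\<^bsub>V\<^esub> u'"
    unfolding eq using c assms by (simp add: M.a_assoc M.r_neg)
  finally have "(a \<ominus> a') \<odot>\<^bsub>V\<^esub> x \<in> U"
    using assms submodule_minus[OF U] by auto
  then show False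
    using submodule_smult_iff[OF U x(1), of "a \<ominus> a'"] assms \<open>a \<noteq> a'\<close> by auto
qed

lemma inj_on_translate: "A \<subseteq> carrier V \<Longrightarrow> y \<in> carrier V \<Longrightarrow> inj_on (\<lambda>u. u \<oplus>\<^bsub>V\<^esub> y) A"
  by (auto simp: inj_on_def subset_iff)

lemma pairwise_disjnt_adjoin:
  assumes "submodule K U V" "x \<in> carrier V" "x \<notin> U"
  shows "pairwise (\<lambda>a b. disjnt ((\<lambda>u. u \<oplus>\<^bsub>V\<^esub> a \<odot>\<^bsub>V\<^esub> x) ` U) ((\<lambda>u. u \<oplus>\<^bsub>V\<^esub> b \<odot>\<^bsub>V\<^esub> x) ` U)) (carrier K)"
  using adjoin_coset_disjoint[OF assms] by (fastforce simp: pairwise_def disjnt_def)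

lemma has_dim_card: "has_dim k U \<Longrightarrow> card U = q ^ k"
proof (induction rule: has_dim.induct)
  case (adjoin k U x)
  note sub = has_dim_subset[OF adjoin(1)]
  have "card (adjoin U x) = (\<Sum>a\<in>carrier K. card ((\<lambda>u. u \<oplus>\<^bsub>V\<^esub> a \<odot>\<^bsub>V\<^esub> x) ` U))"
    unfolding adjoin_def
    using pairwise_disjnt_adjoin[OF has_dim_submodule[OF adjoin(1)] adjoin(2,3)]
      has_dim_finite[OF adjoin(1)] finite_K
    by (intro card_UN_disjoint) (auto simp: pairwise_def disjnt_def)
  also have "\<dots> = (\<Sum>a\<in>carrier K. q ^ k)"
    using sub adjoin by (intro sum.cong refl) (simp add: card_image inj_on_translate)
  finally show ?case by simp
qed auto

lemma finsum_adjoin: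
  assumes "submodule K U V" "x \<in> carrier V" "x \<notin> U" "f \<in> carrier V \<rightarrow> carrier K"
  shows "(\<Oplus>y\<in>adjoin U x. f y) = (\<Oplus>a\<in>carrier K. \<Oplus>u\<in>U. f (u \<oplus>\<^bsub>V\<^esub> a \<odot>\<^bsub>V\<^esub> x))"
proof -
  have sub: "U \<subseteq> carrier V" using assms(1) submodule.subset by blast
  have fin: "finite U" using sub finite_V finite_subset by blast
  have "(\<Oplus>y\<in>adjoin U x. f y) = (\<Oplus>a\<in>carrier K. \<Oplus>y\<in>(\<lambda>u. u \<oplus>\<^bsub>V\<^esub> a \<odot>\<^bsub>V\<^esub> x) ` U. f y)"
    unfolding adjoin_def
    by (rule R.add.finprod_UN_disjoint)
      (use assms sub fin finite_K pairwise_disjnt_adjoin[OF assms(1-3)] in auto)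
  also have "\<dots> = (\<Oplus>a\<in>carrier K. \<Oplus>u\<in>U. f (u \<oplus>\<^bsub>V\<^esub> a \<odot>\<^bsub>V\<^esub> x))"
  proof (rule R.finsum_cong'[OF refl])
    fix a assume "a \<in> carrier K"
    then show "(\<Oplus>y\<in>(\<lambda>u. u \<oplus>\<^bsub>V\<^esub> a \<odot>\<^bsub>V\<^esub> x) ` U. f y) = (\<Oplus>u\<in>U. f (u \<oplus>\<^bsub>V\<^esub> a \<odot>\<^bsub>V\<^esub> x))"
      using assms sub by (intro R.finsum_reindex inj_on_translate) auto
  qed (use assms sub in \<open>auto intro!: R.finsum_closed\<close>)
  finally show ?thesis .
qed

text \<open>This is the vanishing behind Chevalley-Warning. Expanding along the last adjoined vector
  splits the sum into products of a power sum over the field and a sum of \<open>G j\<close> over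
  \<open>U\<close>. Either \<open>j < q - 1\<close> and the power sum vanishes, or
  \<open>G j\<close> has lost at least \<open>q - 1\<close> degrees and the induction hypothesis
  applies.\<close>

lemma finsum_poly_fun_eq_zero:
  assumes "has_dim m W" "poly_fun e f" "e < (q - 1) * m"
  shows "(\<Oplus>w\<in>W. f w) = \<zero>"
  using assms
proof (induction arbitrary: e f rule: has_dim.induct)
  case (adjoin m U x)
  note U = has_dim_submodule[OF adjoin.hyps(1)]
  note fin = has_dim_finite[OF adjoin.hyps(1)] finite_K
  note sub = subsetD[OF has_dim_subset[OF adjoin.hyps(1)]]
  obtain G where G: "\<And>j. j \<le> e \<Longrightarrow> poly_fun (e - j) (G j)"
    and f: "\<And>z b. z \<in> carrier V \<Longrightarrow> b \<in> carrier K \<Longrightarrow>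
       f (z \<oplus>\<^bsub>V\<^esub> b \<odot>\<^bsub>V\<^esub> x) = (\<Oplus>j\<in>{..e}. b [^] j \<otimes> G j z)"
    using poly_fun_expand_along[OF adjoin.prems(1) adjoin.hyps(2)] by blast
  have Gc: "G j z \<in> carrier K" if "j \<le> e" "z \<in> carrier V" for j z
    using that G poly_fun_closed by blast
  have "(\<Oplus>w\<in>adjoin U x. f w) = (\<Oplus>a\<in>carrier K. \<Oplus>u\<in>U. f (u \<oplus>\<^bsub>V\<^esub> a \<odot>\<^bsub>V\<^esub> x))"
    using adjoin U poly_fun_closed by (intro finsum_adjoin) auto
  also have "\<dots> = (\<Oplus>a\<in>carrier K. \<Oplus>u\<in>U. \<Oplus>j\<in>{..e}. a [^] j \<otimes> G j u)"
    using Gc sub f by (intro R.finsum_cong' refl) auto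
  also have "\<dots> = (\<Oplus>a\<in>carrier K. \<Oplus>j\<in>{..e}. \<Oplus>u\<in>U. a [^] j \<otimes> G j u)"
    using Gc sub fin by (intro R.finsum_cong' refl finsum_swap) auto
  also have "\<dots> = (\<Oplus>j\<in>{..e}. \<Oplus>a\<in>carrier K. \<Oplus>u\<in>U. a [^] j \<otimes> G j u)"
    using Gc sub fin by (intro finsum_swap) auto
  also have "\<dots> = (\<Oplus>j\<in>{..e}. \<zero>)"
  proof (intro R.finsum_cong' refl)
    fix j assume "j \<in> {..e}"
    then have j: "j \<le> e" by simp
    have "(\<Oplus>a\<in>carrier K. \<Oplus>u\<in>U. a [^] j \<otimes> G j u) = (\<Oplus>a\<in>carrier K. a [^] j \<otimes> (\<Oplus>u\<in>U. G j u))"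
      using Gc sub fin j by (intro R.finsum_cong' refl R.finsum_rdistr[symmetric]) auto
    also have "\<dots> = (\<Oplus>a\<in>carrier K. a [^] j) \<otimes> (\<Oplus>u\<in>U. G j u)"
      using Gc sub fin j by (intro R.finsum_ldistr[symmetric]) auto
    also have "\<dots> = \<zero>"
    proof (cases "j < q - 1")
      case True
      then show ?thesis using finsum_pow_eq_zero Gc sub j by auto
    next
      case False
      then have "e - j < (q - 1) * m" using adjoin.prems(2) j q_ge_2 by (simp add: algebra_simps)
      then have "(\<Oplus>u\<in>U. G j u) = \<zero>" using adjoin.IH[OF G[OF j]] by simp
      then show ?thesis by simp
    qed
    finally show "(\<Oplus>a\<in>carrier K. \<Oplus>u\<in>U. a [^] j \<otimes> G j u) = \<zero>" .
  qed auto
  finally show ?case by simp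
qed simp

subsection \<open>Subspaces on which a polynomial function is constant\<close>

text \<open>
  The function \<open>\<chi>\<close> plays the role of the product of all \<open>1 - h ^ (q - 1)\<close> in the proof of the
  Chevalley-Warning theorem, where \<open>h\<close> runs over the equations of a system with solution \<open>0\<close>.
\<close>

definition detectable :: "nat \<Rightarrow> ('c \<Rightarrow> bool) \<Rightarrow> bool" where
  "detectable e Q \<longleftrightarrow> (\<exists>\<chi>. poly_fun e \<chi> \<and> \<chi> \<zero>\<^bsub>V\<^esub> = \<one> \<and> (\<forall>x\<in>carrier V. \<chi> x \<noteq> \<zero> \<longrightarrow> Q x))"

lemma detectable_mono:
  assumes "detectable e Q" "\<And>x. x \<in> carrier V \<Longrightarrow> Q x \<Longrightarrow> Q' x"
  shows "detectable e Q'"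
  using assms unfolding detectable_def by blast

text \<open>Nonzero field elements have power \<open>q - 1\<close> equal to \<open>\<one>\<close>,
  so the witness vanishes wherever \<open>h\<close> does not. Its value at the zero vector is
  \<open>\<one>\<close> because \<open>q - 1 > 0\<close>.\<close>

lemma detectable_zero:
  assumes "poly_fun d h" "h \<zero>\<^bsub>V\<^esub> = \<zero>"
  shows "detectable ((q - 1) * d) (\<lambda>x. h x = \<zero>)"
  unfolding detectable_def
proof (intro exI[of _ "\<lambda>x. \<one> \<ominus> h x [^] (q - 1)"] conjI ballI impI)
  show "poly_fun ((q - 1) * d) (\<lambda>x. \<one> \<ominus> h x [^] (q - 1))"
    using poly_fun_minus[OF poly_fun.const[OF R.one_closed] poly_fun_pow[OF assms(1), of "q - 1"]]
    by (simp add: mult.commute)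
  show "\<one> \<ominus> h \<zero>\<^bsub>V\<^esub> [^] (q - 1) = \<one>"
    using assms(2) q_ge_2 by (simp add: nat_pow_zero a_minus_def)
next
  fix x assume x: "x \<in> carrier V" and "\<one> \<ominus> h x [^] (q - 1) \<noteq> \<zero>"
  then show "h x = \<zero>"
    using pow_q_minus_1[of "h x"] poly_fun_closed[OF assms(1) x] by auto
qed

text \<open>Witnesses are multiplied, so their degrees add up; in a field a product is nonzero only
  if all its factors are.\<close>

lemma detectable_all:
  assumes "\<And>j. j < m \<Longrightarrow> detectable (e j) (Q j)"
  shows "detectable (\<Sum>j<m. e j) (\<lambda>x. \<forall>j<(m::nat). Q j x)"
  using assms
proof (induction m)
  case 0
  show ?case
    unfolding detectable_def by (intro exI[of _ "\<lambda>_. \<one>"]) (auto intro: poly_fun.const)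
next
  case (Suc m)
  have "detectable (\<Sum>j<m. e j) (\<lambda>x. \<forall>j<m. Q j x)" using Suc by simp
  then obtain \<phi> where \<phi>: "poly_fun (\<Sum>j<m. e j) \<phi>" "\<phi> \<zero>\<^bsub>V\<^esub> = \<one>"
    "\<forall>x\<in>carrier V. \<phi> x \<noteq> \<zero> \<longrightarrow> (\<forall>j<m. Q j x)"
    unfolding detectable_def by (elim exE conjE)
  have "detectable (e m) (Q m)" using Suc by simp
  then obtain \<psi> where \<psi>: "poly_fun (e m) \<psi>" "\<psi> \<zero>\<^bsub>V\<^esub> = \<one>"
    "\<forall>x\<in>carrier V. \<psi> x \<noteq> \<zero> \<longrightarrow> Q m x"
    unfolding detectable_def by (elim exE conjE)
  show ?case
    unfolding detectable_def
  proof (intro exI[of _ "\<lambda>x. \<phi> x \<otimes> \<psi> x"] conjI ballI impI)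
    show "poly_fun (\<Sum>j<Suc m. e j) (\<lambda>x. \<phi> x \<otimes> \<psi> x)"
      using poly_fun_mult[OF \<phi>(1) \<psi>(1)] by simp
    show "\<phi> \<zero>\<^bsub>V\<^esub> \<otimes> \<psi> \<zero>\<^bsub>V\<^esub> = \<one>" using \<phi> \<psi> by simp
  next
    fix x assume x: "x \<in> carrier V" and nz: "\<phi> x \<otimes> \<psi> x \<noteq> \<zero>"
    then have "\<phi> x \<noteq> \<zero>" "\<psi> x \<noteq> \<zero>"
      using poly_fun_closed[OF \<phi>(1) x] poly_fun_closed[OF \<psi>(1) x] by auto
    then show "\<forall>j<Suc m. Q j x" using \<phi>(3) \<psi>(3) x by (auto simp: less_Suc_eq)
  qed
qed

text \<open>The hockey-stick identity after reversing the order of summation; its lowest term,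
  \<open>k + 1\<close> over \<open>k + 2\<close>, is zero.\<close>

lemma sum_choose_shift: "(\<Sum>j<Suc d. (k + (d - j) + 1) choose (k + 2)) = (k + d + 2) choose (k + 3)"
proof -
  have "(\<Sum>j<Suc d. (k + (d - j) + 1) choose (k + 2)) = (\<Sum>i<Suc d. (k + i + 1) choose (k + 2))"
    using sum.nat_diff_reindex[of "\<lambda>i. (k + i + 1) choose (k + 2)" "Suc d"]
    by simp
  also have "\<dots> = (k + d + 2) choose (k + 3)"
    by (induction d) (simp_all add: numeral_3_eq_3)
  finally show ?thesis .
qed

lemma sum_Suc_choose: "(\<Sum>j<d. Suc j) = Suc d choose 2"
  by (induction d) (simp_all add: numeral_2_eq_2)

text \<open>
  The induction expands \<open>f\<close> along the last vector \<open>y\<close> adjoined to \<open>U\<close>: it is enough that \<open>x\<close> extends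
  the smaller subspace for each coefficient of a power of the multiplier of \<open>y\<close>.  The resulting
  recursion for the total degree is solved by a hockey-stick sum.
\<close>

lemma detectable_extension:
  assumes "has_dim k U" "poly_fun d f"
  shows "detectable ((q - 1) * ((k + d + 1) choose (k + 2)))
    (\<lambda>x. \<forall>u\<in>U. \<forall>a\<in>carrier K. f (u \<oplus>\<^bsub>V\<^esub> a \<odot>\<^bsub>V\<^esub> x) = f u)"
  using assms
proof (induction arbitrary: d f rule: has_dim.induct)
  case zero
  from poly_fun_expand_homogeneous[OF zero]
  obtain H where H: "\<forall>j\<le>d. poly_fun j (H j) \<and> (j > 0 \<longrightarrow> H j \<zero>\<^bsub>V\<^esub> = \<zero>)"
    and f: "\<forall>x\<in>carrier V. \<forall>b\<in>carrier K. f (b \<odot>\<^bsub>V\<^esub> x) = (\<Oplus>j\<in>{..d}. b [^] j \<otimes> H j x)"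
    by (elim exE conjE)
  \<comment> \<open>There is one equation for each positive power of the multiplier, of degrees
    \<open>1\<close> to \<open>d\<close>; the constant coefficient \<open>H 0\<close> imposes
    none.\<close>
  have "detectable (\<Sum>j<d. (q - 1) * Suc j) (\<lambda>x. \<forall>j<d. H (Suc j) x = \<zero>)"
    using H by (intro detectable_all detectable_zero) (simp_all add: Suc_le_eq)
  moreover have "(\<Sum>j<d. (q - 1) * Suc j) = (q - 1) * ((0 + d + 1) choose (0 + 2))"
    unfolding sum_distrib_left[symmetric] sum_Suc_choose by (simp add: numeral_2_eq_2)
  ultimately have "detectable ((q - 1) * ((0 + d + 1) choose (0 + 2))) (\<lambda>x. \<forall>j<d. H (Suc j) x = \<zero>)"
    by simp
  then show ?case
  proof (rule detectable_mono)
    fix x assume x: "x \<in> carrier V" and z: "\<forall>j<d. H (Suc j) x = \<zero>"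
    have c: "H 0 x \<in> carrier K" using H x poly_fun_closed by blast
    have eq: "f (b \<odot>\<^bsub>V\<^esub> x) = H 0 x" if b: "b \<in> carrier K" for b
    proof -
      have "f (b \<odot>\<^bsub>V\<^esub> x) = (\<Oplus>j\<in>{..d}. b [^] j \<otimes> H j x)" using f x b by simp
      also have "\<dots> = (\<Oplus>j\<in>{..d}. b [^] j \<otimes> (if j = 0 then H 0 x else \<zero>))"
      proof (rule R.finsum_cong'[OF refl])
        fix j assume "j \<in> {..d}"
        then show "b [^] j \<otimes> H j x = b [^] j \<otimes> (if j = 0 then H 0 x else \<zero>)"
          using z by (cases j) auto
      qed (use b c in auto)
      finally show ?thesis using finsum_pow_head b c by simp
    qed
    show "\<forall>u\<in>{\<zero>\<^bsub>V\<^esub>}. \<forall>a\<in>carrier K. f (u \<oplus>\<^bsub>V\<^esub> a \<odot>\<^bsub>V\<^esub> x) = f u"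
      using eq eq[of \<zero>] x by simp
  qed
next
  case (adjoin k U y)
  note sub = subsetD[OF has_dim_subset[OF adjoin.hyps(1)]]
  from poly_fun_expand_along[OF adjoin.prems adjoin.hyps(2)]
  obtain G where G: "\<forall>j\<le>d. poly_fun (d - j) (G j)"
    and f: "\<forall>z\<in>carrier V. \<forall>b\<in>carrier K.
       f (z \<oplus>\<^bsub>V\<^esub> b \<odot>\<^bsub>V\<^esub> y) = (\<Oplus>j\<in>{..d}. b [^] j \<otimes> G j z)"
    by (elim exE conjE)
  have "detectable (\<Sum>j<Suc d. (q - 1) * ((k + (d - j) + 1) choose (k + 2)))
    (\<lambda>x. \<forall>j<Suc d. \<forall>u\<in>U. \<forall>a\<in>carrier K. G j (u \<oplus>\<^bsub>V\<^esub> a \<odot>\<^bsub>V\<^esub> x) = G j u)"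
    using G by (intro detectable_all adjoin.IH) simp
  moreover have "(\<Sum>j<Suc d. (q - 1) * ((k + (d - j) + 1) choose (k + 2))) =
      (q - 1) * ((Suc k + d + 1) choose (Suc k + 2))"
    unfolding sum_distrib_left[symmetric] sum_choose_shift by (simp add: numeral_3_eq_3)
  ultimately have "detectable ((q - 1) * ((Suc k + d + 1) choose (Suc k + 2)))
    (\<lambda>x. \<forall>j<Suc d. \<forall>u\<in>U. \<forall>a\<in>carrier K. G j (u \<oplus>\<^bsub>V\<^esub> a \<odot>\<^bsub>V\<^esub> x) = G j u)"
    by simp
  then show ?case
  proof (rule detectable_mono, intro ballI)
    fix x w a assume x: "x \<in> carrier V" and w: "w \<in> adjoin U y" and a: "a \<in> carrier K"
      and *: "\<forall>j<Suc d. \<forall>u\<in>U. \<forall>a\<in>carrier K. G j (u \<oplus>\<^bsub>V\<^esub> a \<odot>\<^bsub>V\<^esub> x) = G j u"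
    from w obtain u b where u: "u \<in> U" and b: "b \<in> carrier K" and w: "w = u \<oplus>\<^bsub>V\<^esub> b \<odot>\<^bsub>V\<^esub> y"
      by (auto simp: adjoin_iff)
    have y: "y \<in> carrier V" by fact
    have uV: "u \<in> carrier V" using u sub by auto
    \<comment> \<open>With \<open>y\<close> moved to the outside, both sides of the goal expand in
      the powers of the same \<open>b\<close>, so equality of the coefficients at \<open>u\<close>
      and at the shifted \<open>u\<close> suffices.\<close>
    have "w \<oplus>\<^bsub>V\<^esub> a \<odot>\<^bsub>V\<^esub> x = (u \<oplus>\<^bsub>V\<^esub> a \<odot>\<^bsub>V\<^esub> x) \<oplus>\<^bsub>V\<^esub> b \<odot>\<^bsub>V\<^esub> y"
      using uV a b x y unfolding w by (simp add: M.a_ac)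
    then have "f (w \<oplus>\<^bsub>V\<^esub> a \<odot>\<^bsub>V\<^esub> x) = (\<Oplus>j\<in>{..d}. b [^] j \<otimes> G j (u \<oplus>\<^bsub>V\<^esub> a \<odot>\<^bsub>V\<^esub> x))"
      using f uV a b x by simp
    also have "\<dots> = (\<Oplus>j\<in>{..d}. b [^] j \<otimes> G j u)"
    proof (rule R.finsum_cong'[OF refl])
      show "(\<lambda>j. b [^] j \<otimes> G j u) \<in> {..d} \<rightarrow> carrier K"
        using G b uV poly_fun_closed by blast
    qed (use * u a in auto)
    also have "\<dots> = f w" using f uV b w by simp
    finally show "f (w \<oplus>\<^bsub>V\<^esub> a \<odot>\<^bsub>V\<^esub> x) = f w" .
  qed
qed

lemma adjoin_subset:
  assumes "submodule K W V" "U \<subseteq> W" "x \<in> W"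
  shows "adjoin U x \<subseteq> W"
proof -
  interpret W: submodule K W V by fact
  show ?thesis
    using assms(2,3) by (auto simp: adjoin_iff subset_iff intro!: W.m_closed W.smult_closed)
qed

lemma submodule_Int_zero: "submodule K U V \<Longrightarrow> submodule K C V \<Longrightarrow> \<zero>\<^bsub>V\<^esub> \<in> C \<inter> U"
  by (simp add: submodule.zero_closed)

text \<open>A complement of \<open>U\<close> in \<open>W\<close> is grown one vector at a time;
  nonzero vectors of it are automatically outside \<open>U\<close>. Counting replaces an exchange
  argument.\<close>

lemma exists_disjoint_subspace:
  assumes U: "has_dim k U" and W: "has_dim m W" and UW: "U \<subseteq> W" and "i + k \<le> m"
  shows "\<exists>C. has_dim i C \<and> C \<subseteq> W \<and> C \<inter> U = {\<zero>\<^bsub>V\<^esub>}"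
  using assms(4)
proof (induction i)
  case 0
  show ?case
    using has_dim.zero submodule.zero_closed[OF has_dim_submodule[OF U]] UW
    by (intro exI[of _ "{\<zero>\<^bsub>V\<^esub>}"]) auto
next
  case (Suc i)
  then obtain C where C: "has_dim i C" "C \<subseteq> W" "C \<inter> U = {\<zero>\<^bsub>V\<^esub>}" by auto
  note subm = has_dim_submodule[OF U] has_dim_submodule[OF C(1)] has_dim_submodule[OF W]
  define S where "S = submodule_sum U C"
  have S: "submodule K S V"
    unfolding S_def using subm by (intro sum_is_submodule)
  have S_eq: "S = (\<lambda>(x, y). x \<oplus>\<^bsub>V\<^esub> y) ` (U \<times> C)"
    by (auto simp: S_def submodule_sum_def)
  \<comment> \<open>The sum of \<open>U\<close> and \<open>C\<close> has too few elements to cover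
    \<open>W\<close>, so a vector \<open>x\<close> outside it is available.\<close>
  have "card S \<le> card (U \<times> C)"
    unfolding S_eq using has_dim_finite U C by (intro card_image_le) auto
  also have "\<dots> = q ^ (i + k)"
    using has_dim_card U C by (simp add: card_cartesian_product power_add)
  also have "\<dots> < q ^ m"
    using Suc.prems q_ge_2 by (intro power_strict_increasing) auto
  also have "\<dots> = card W" using has_dim_card[OF W] by simp
  finally have "\<not> W \<subseteq> S"
    using card_mono[of S W] has_dim_finite U C unfolding S_eq by fastforce
  then obtain x where x: "x \<in> W" "x \<notin> S" by blast
  have xV: "x \<in> carrier V" using x has_dim_subset[OF W] by auto
  have CS: "C \<subseteq> S" and US: "U \<subseteq> S"
  proof -
    have "c = \<zero>\<^bsub>V\<^esub> \<oplus>\<^bsub>V\<^esub> c" if "c \<in> C" for c using that has_dim_subset[OF C(1)] by auto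
    then show "C \<subseteq> S" unfolding S_eq using submodule.zero_closed[OF subm(1)] by force
    have "c = c \<oplus>\<^bsub>V\<^esub> \<zero>\<^bsub>V\<^esub>" if "c \<in> U" for c using that has_dim_subset[OF U] by auto
    then show "U \<subseteq> S" unfolding S_eq using submodule.zero_closed[OF subm(2)] by force
  qed
  have "has_dim (Suc i) (adjoin C x)"
    using C(1) xV x CS by (intro has_dim.adjoin) auto
  moreover have "adjoin C x \<subseteq> W"
    using subm C x by (intro adjoin_subset) auto
  moreover have "adjoin C x \<inter> U \<subseteq> {\<zero>\<^bsub>V\<^esub>}"
  proof
    fix w assume w: "w \<in> adjoin C x \<inter> U"
    then obtain c a where c: "c \<in> C" "a \<in> carrier K" "w = c \<oplus>\<^bsub>V\<^esub> a \<odot>\<^bsub>V\<^esub> x"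
      by (auto simp: adjoin_iff)
    have cV: "c \<in> carrier V" using c has_dim_subset[OF C(1)] by auto
    \<comment> \<open>A nonzero multiplier could be divided out, which would put \<open>x\<close>
      into the sum of \<open>U\<close> and \<open>C\<close>.\<close>
    have "a = \<zero>"
    proof (rule ccontr)
      assume a: "a \<noteq> \<zero>"
      have "a \<odot>\<^bsub>V\<^esub> x = \<ominus>\<^bsub>V\<^esub> c \<oplus>\<^bsub>V\<^esub> w"
        using c cV xV by (simp add: M.r_neg1)
      moreover have "\<ominus>\<^bsub>V\<^esub> c \<oplus>\<^bsub>V\<^esub> w \<in> S"
        using submodule_minus[OF S] CS US c w by (intro submodule.m_closed[OF S]) auto
      ultimately show False
        using submodule_smult_iff[OF S xV c(2) a] x by simp
    qed
    then have "w = c" using c cV xV by simp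
    then show "w \<in> {\<zero>\<^bsub>V\<^esub>}" using c w C by auto
  qed
  moreover have "\<zero>\<^bsub>V\<^esub> \<in> adjoin C x \<inter> U"
    using subm xV by (intro submodule_Int_zero submodule_adjoin)
  ultimately show ?case by blast
qed

text \<open>On a complement \<open>C\<close> of dimension \<open>m - k\<close> the degree of
  \<open>\<chi>\<close> is below \<open>(q - 1) * (m - k)\<close>, so its values sum to zero. Since
  the zero vector contributes \<open>\<one>\<close>, a further vector of \<open>C\<close> must
  contribute.\<close>

lemma extend_constant_subspace:
  assumes U: "has_dim k U" and W: "has_dim m W" and UW: "U \<subseteq> W" and f: "poly_fun d f"
    and less: "((k + d + 1) choose (k + 2)) + k < m"
  shows "\<exists>x\<in>W. x \<notin> U \<and> (\<forall>u\<in>U. \<forall>a\<in>carrier K. f (u \<oplus>\<^bsub>V\<^esub> a \<odot>\<^bsub>V\<^esub> x) = f u)"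
proof -
  obtain C where C: "has_dim (m - k) C" "C \<subseteq> W" "C \<inter> U = {\<zero>\<^bsub>V\<^esub>}"
    using exists_disjoint_subspace[OF U W UW, of "m - k"] less by auto
  let ?N = "(k + d + 1) choose (k + 2)"
  from detectable_extension[OF U f] obtain \<chi> where \<chi>: "poly_fun ((q - 1) * ?N) \<chi>" "\<chi> \<zero>\<^bsub>V\<^esub> = \<one>"
    "\<forall>x\<in>carrier V. \<chi> x \<noteq> \<zero> \<longrightarrow> (\<forall>u\<in>U. \<forall>a\<in>carrier K. f (u \<oplus>\<^bsub>V\<^esub> a \<odot>\<^bsub>V\<^esub> x) = f u)"
    unfolding detectable_def by (elim exE conjE)
  note sub = has_dim_subset[OF C(1)]
  have 0: "(\<Oplus>x\<in>C. \<chi> x) = \<zero>"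
    using less q_ge_2 by (intro finsum_poly_fun_eq_zero[OF C(1) \<chi>(1)]) auto
  have "\<exists>x\<in>C. x \<noteq> \<zero>\<^bsub>V\<^esub> \<and> \<chi> x \<noteq> \<zero>"
  proof (rule ccontr)
    assume "\<not> (\<exists>x\<in>C. x \<noteq> \<zero>\<^bsub>V\<^esub> \<and> \<chi> x \<noteq> \<zero>)"
    then have "(\<Oplus>x\<in>C. \<chi> x) = (\<Oplus>x\<in>C. if \<zero>\<^bsub>V\<^esub> = x then \<one> else \<zero>)"
      using \<chi>(2) by (intro R.finsum_cong') auto
    also have "\<dots> = \<one>"
      using submodule.zero_closed[OF has_dim_submodule[OF C(1)]] has_dim_finite[OF C(1)]
      by (intro R.add.finprod_singleton) auto
    finally show False using 0 by simp
  qed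
  then obtain x where x: "x \<in> C" "x \<noteq> \<zero>\<^bsub>V\<^esub>" "\<chi> x \<noteq> \<zero>" by blast
  then show ?thesis using C sub \<chi>(3) by (intro bexI[of _ x]) auto
qed

text \<open>The threshold for \<open>Suc k\<close> is exactly the condition for extending a
  \<open>k\<close>-dimensional subspace. The case \<open>k = 0\<close> is listed apart because the
  formula would demand \<open>d \<le> m\<close> there, while the zero subspace always
  exists.\<close>

lemma exists_constant_subspace:
  assumes W: "has_dim m W" and f: "poly_fun d f"
    and "k = 0 \<or> ((k + d) choose (k + 1)) + k \<le> m"
  shows "\<exists>U. has_dim k U \<and> U \<subseteq> W \<and> (\<forall>u\<in>U. f u = f \<zero>\<^bsub>V\<^esub>)"
  using assms(3)
proof (induction k)
  case 0
  show ?case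
    using has_dim.zero submodule.zero_closed[OF has_dim_submodule[OF W]]
    by (intro exI[of _ "{\<zero>\<^bsub>V\<^esub>}"]) auto
next
  case (Suc k)
  have le: "((k + d + 1) choose (k + 2)) + k < m" using Suc.prems by simp
  \<comment> \<open>By Pascal's rule the threshold for \<open>k\<close> lies below the one for
    \<open>Suc k\<close>.\<close>
  then have "((k + d) choose (k + 1)) + k \<le> m" by simp
  then obtain U where U: "has_dim k U" "U \<subseteq> W" "\<forall>u\<in>U. f u = f \<zero>\<^bsub>V\<^esub>" using Suc.IH by blast
  obtain x where x: "x \<in> W" "x \<notin> U" "\<forall>u\<in>U. \<forall>a\<in>carrier K. f (u \<oplus>\<^bsub>V\<^esub> a \<odot>\<^bsub>V\<^esub> x) = f u"
    using extend_constant_subspace[OF U(1) W U(2) f le] by blast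
  have "has_dim (Suc k) (adjoin U x)"
    using U x has_dim_subset[OF W] by (intro has_dim.adjoin) auto
  moreover have "adjoin U x \<subseteq> W"
    using adjoin_subset[OF has_dim_submodule[OF W]] U x by simp
  moreover have "\<forall>w\<in>adjoin U x. f w = f \<zero>\<^bsub>V\<^esub>"
    using U x by (auto simp: adjoin_iff)
  ultimately show ?case by blast
qed

end

subsection \<open>Partitions into cosets\<close>

lemma partition_on_refine:
  assumes "partition_on A P" "\<And>B. B \<in> P \<Longrightarrow> partition_on B (R B)"
  shows "partition_on A (\<Union>B\<in>P. R B)"
proof (rule partition_onI)
  show "\<Union>(\<Union>B\<in>P. R B) = A"
    using partition_onD1[OF assms(1)] partition_onD1[OF assms(2)] by fastforce
next
  fix S T assume S: "S \<in> (\<Union>B\<in>P. R B)" and T: "T \<in> (\<Union>B\<in>P. R B)" and ne: "S \<noteq> T"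
  then obtain B C where *: "B \<in> P" "S \<in> R B" "C \<in> P" "T \<in> R C" by auto
  show "disjnt S T"
  proof (cases "B = C")
    case True
    then show ?thesis
      using * ne partition_onD2[OF assms(2)[of B]] by (auto simp: disjoint_def disjnt_def)
  next
    case False
    have "S \<subseteq> B" "T \<subseteq> C"
      using * partition_onD1[OF assms(2)[of B]] partition_onD1[OF assms(2)[of C]] by auto
    moreover have "B \<inter> C = {}"
      using * False partition_onD2[OF assms(1)] by (auto simp: disjoint_def)
    ultimately show ?thesis by (auto simp: disjnt_def)
  qed
next
  show "{} \<notin> (\<Union>B\<in>P. R B)" using partition_onD3[OF assms(2)] by auto
qed

section \<open>Estimates for the dimension gained in one round\<close>

lemma binomial_le_Suc_power: "(n + r) choose r \<le> Suc n ^ r"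
proof (induction r)
  case (Suc r)
  have "Suc r * ((n + Suc r) choose Suc r) = Suc (n + r) * ((n + r) choose r)"
    using Suc_times_binomial_eq[of "n + r" r] by (simp add: mult.commute)
  \<comment> \<open>\<open>Suc (n + r) \<le> Suc r * Suc n\<close>, so each increase of
    \<open>r\<close> costs a factor of at most \<open>Suc n\<close>.\<close>
  also have "\<dots> \<le> (Suc r * Suc n) * Suc n ^ r"
    using Suc by (intro mult_mono) auto
  also have "\<dots> = Suc r * Suc n ^ Suc r" by (simp only: power_Suc mult.assoc)
  finally show ?case by (simp only: Suc_mult_le_cancel1)
qed simp

text \<open>This is for degree \<open>e + 2\<close>. The largest \<open>k\<close> with
  \<open>(4 * k) ^ Suc e \<le> m\<close> works: maximality bounds \<open>m\<close> from above, and
  the binomial is a polynomial in \<open>k\<close> of degree \<open>e + 1\<close> small enough to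
  fit below \<open>m\<close>.\<close>

lemma exists_subspace_dimension:
  "\<exists>k. (k = 0 \<or> ((k + Suc (Suc e)) choose (k + 1)) + k \<le> m) \<and> m \<le> (4 * (k + 1)) ^ Suc e"
proof -
  define Q where "Q k \<longleftrightarrow> k = 0 \<or> (4 * k) ^ Suc e \<le> m" for k
  have bound: "k \<le> m" if "Q k" for k
  proof (cases "k = 0")
    case False
    then have "4 * k \<le> (4 * k) ^ Suc e" by (intro self_le_power) auto
    then show ?thesis using that False unfolding Q_def by linarith
  qed simp
  have "Q 0" by (simp add: Q_def)
  then obtain k where k: "Q k" and max: "\<And>j. Q j \<Longrightarrow> j \<le> k"
    using GreatestI_nat[of Q 0 m] Greatest_le_nat[of Q _ m] bound by blast
  have "\<not> Q (Suc k)" using max[of "Suc k"] by auto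
  then have m: "m \<le> (4 * (k + 1)) ^ Suc e" by (simp add: Q_def)
  have "((k + Suc (Suc e)) choose (k + 1)) + k \<le> m" if "k \<noteq> 0"
  proof -
    \<comment> \<open>Symmetry makes the lower index independent of \<open>k\<close>.\<close>
    have "(k + Suc (Suc e)) choose (k + 1) = (Suc k + Suc e) choose Suc e"
      using binomial_symmetric[of "k + 1" "k + Suc (Suc e)"] by simp
    also have "\<dots> \<le> (k + 2) ^ Suc e" using binomial_le_Suc_power[of "Suc k" "Suc e"] by simp
    also have "\<dots> \<le> (3 * k) ^ Suc e" using that by (intro power_mono) auto
    also have "\<dots> \<le> (3 * k) * (4 * k) ^ e" by (simp add: power_mono)
    \<comment> \<open>The gap between the factors \<open>3 * k\<close> and \<open>4 * k\<close>
      absorbs the additional \<open>k\<close>.\<close>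
    finally have "((k + Suc (Suc e)) choose (k + 1)) + k \<le> (3 * k) * (4 * k) ^ e + k * (4 * k) ^ e"
      using that by (intro add_mono) auto
    also have "\<dots> = (4 * k) ^ Suc e" by (simp add: algebra_simps)
    also have "\<dots> \<le> m" using k that by (simp add: Q_def)
    finally show ?thesis .
  qed
  then have "k = 0 \<or> ((k + Suc (Suc e)) choose (k + 1)) + k \<le> m"
    unfolding disj_imp by (rule impI)
  then show ?thesis using m by (intro exI conjI)
qed

text \<open>
  For degree \<open>e + 1\<close>, a part of dimension \<open>k\<close> satisfies
  \<open>m \<le> 8 ^ loss e * (k + 1) ^ fact e\<close>; the recursion comes from
  \<open>m \<le> (4 * (k' + 1)) ^ e\<close> for the dimension \<open>k'\<close> of the subspace chosen first.
\<close>

fun loss :: "nat \<Rightarrow> nat" where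
  "loss 0 = 0"
| "loss (Suc e) = Suc e * (1 + loss e)"

text \<open>A bound linear in \<open>fact e\<close> makes the \<open>fact e\<close>-th root of
  \<open>8 ^ loss e\<close> at most \<open>8 ^ 3\<close>, so the final constant does not depend on
  the degree. The summand \<open>2\<close> lets the recursion close, using
  \<open>2 \<le> Suc e\<close> for \<open>e > 0\<close>.\<close>

lemma loss_le: "loss e + 2 \<le> 3 * fact e"
proof (induction e)
  case (Suc e)
  show ?case
  proof (cases "e = 0")
    case False
    have "loss (Suc e) + 2 \<le> Suc e * (1 + loss e) + Suc e" using False by simp
    also have "\<dots> = Suc e * (loss e + 2)" by simp
    also have "\<dots> \<le> Suc e * (3 * fact e)" using Suc by (intro mult_left_mono) auto
    finally show ?thesis by simp
  qed simp
qed simp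

context finite_vectorspace
begin

abbreviation coset :: "'c \<Rightarrow> 'c set \<Rightarrow> 'c set" where
  "coset v U \<equiv> (\<lambda>u. v \<oplus>\<^bsub>V\<^esub> u) ` U"

lemma coset_subset:
  assumes U: "submodule K U V" and v: "v \<in> carrier V" "v' \<in> carrier V"
    and u: "u \<in> U" "u' \<in> U" and eq: "v \<oplus>\<^bsub>V\<^esub> u = v' \<oplus>\<^bsub>V\<^esub> u'"
  shows "coset v U \<subseteq> coset v' U"
proof
  interpret U: submodule K U V by fact
  have c: "t \<in> carrier V" if "t \<in> U" for t using that U.subset by auto
  fix x assume "x \<in> coset v U"
  then obtain t where t: "t \<in> U" "x = v \<oplus>\<^bsub>V\<^esub> t" by auto
  have "v = v \<oplus>\<^bsub>V\<^esub> u \<oplus>\<^bsub>V\<^esub> \<ominus>\<^bsub>V\<^esub> u" using v(1) c[OF u(1)] by (simp add: M.a_assoc M.r_neg)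
  then have "x = v' \<oplus>\<^bsub>V\<^esub> (u' \<oplus>\<^bsub>V\<^esub> \<ominus>\<^bsub>V\<^esub> u \<oplus>\<^bsub>V\<^esub> t)"
    using t(2) v c[OF u(1)] c[OF u(2)] c[OF t(1)] unfolding eq by (metis M.a_assoc M.a_closed M.a_inv_closed)
  moreover have "u' \<oplus>\<^bsub>V\<^esub> \<ominus>\<^bsub>V\<^esub> u \<oplus>\<^bsub>V\<^esub> t \<in> U"
    using u t submodule_minus[OF U] by (intro U.m_closed) auto
  ultimately show "x \<in> coset v' U" by blast
qed

lemma partition_on_cosets:
  assumes U: "submodule K U V" and W: "submodule K W V" and UW: "U \<subseteq> W" and v: "v \<in> carrier V"
  shows "partition_on (coset v W) ((\<lambda>w. coset (v \<oplus>\<^bsub>V\<^esub> w) U) ` W)"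
proof (rule partition_onI)
  interpret U: submodule K U V by fact
  interpret W: submodule K W V by fact
  note c = subsetD[OF W.subset] subsetD[OF U.subset]
  show "\<Union>((\<lambda>w. coset (v \<oplus>\<^bsub>V\<^esub> w) U) ` W) = coset v W"
  proof (intro equalityI subsetI)
    fix x assume "x \<in> \<Union>((\<lambda>w. coset (v \<oplus>\<^bsub>V\<^esub> w) U) ` W)"
    then obtain w u where wu: "w \<in> W" "u \<in> U" "x = v \<oplus>\<^bsub>V\<^esub> w \<oplus>\<^bsub>V\<^esub> u" by auto
    then have "x = v \<oplus>\<^bsub>V\<^esub> (w \<oplus>\<^bsub>V\<^esub> u)" "w \<oplus>\<^bsub>V\<^esub> u \<in> W"
      using c v UW by (auto simp: M.a_assoc)
    then show "x \<in> coset v W" by blast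
  next
    fix x assume "x \<in> coset v W"
    then obtain w where w: "w \<in> W" "x = v \<oplus>\<^bsub>V\<^esub> w" by auto
    then have "x = v \<oplus>\<^bsub>V\<^esub> w \<oplus>\<^bsub>V\<^esub> \<zero>\<^bsub>V\<^esub>" using c v by auto
    then show "x \<in> \<Union>((\<lambda>w. coset (v \<oplus>\<^bsub>V\<^esub> w) U) ` W)" using w U.zero_closed by blast
  qed
  show "{} \<notin> (\<lambda>w. coset (v \<oplus>\<^bsub>V\<^esub> w) U) ` W"
    using U.zero_closed by blast
  fix S T assume S: "S \<in> (\<lambda>w. coset (v \<oplus>\<^bsub>V\<^esub> w) U) ` W" and T: "T \<in> (\<lambda>w. coset (v \<oplus>\<^bsub>V\<^esub> w) U) ` W"
    and ne: "S \<noteq> T"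
  then obtain w w' where w: "w \<in> W" "w' \<in> W"
    "S = coset (v \<oplus>\<^bsub>V\<^esub> w) U" "T = coset (v \<oplus>\<^bsub>V\<^esub> w') U" by auto
  have c': "v \<oplus>\<^bsub>V\<^esub> w \<in> carrier V" "v \<oplus>\<^bsub>V\<^esub> w' \<in> carrier V" using w c v by auto
  show "disjnt S T"
    unfolding disjnt_def
  proof (rule ccontr)
    assume "S \<inter> T \<noteq> {}"
    then obtain u u' where uu: "u \<in> U" "u' \<in> U" "v \<oplus>\<^bsub>V\<^esub> w \<oplus>\<^bsub>V\<^esub> u = v \<oplus>\<^bsub>V\<^esub> w' \<oplus>\<^bsub>V\<^esub> u'"
      unfolding w by auto
    have "S = T"
      unfolding w using coset_subset[OF U c' uu] coset_subset[OF U c'(2,1) uu(2,1) uu(3)[symmetric]]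
      by (rule equalityI)
    then show False using ne by simp
  qed
qed

text \<open>Since \<open>g u = g \<zero>\<close> on \<open>U\<close>, the value
  \<open>g (u \<oplus> w)\<close> equals the constant \<open>g \<zero>\<close> plus the discrete
  derivative of \<open>g\<close> in direction \<open>w\<close> at \<open>u\<close>, which has lower
  degree.\<close>

lemma poly_fun_on_coset:
  assumes g: "poly_fun (Suc d) g" and v: "v \<in> carrier V" and W: "submodule K W V"
    and f: "\<And>w. w \<in> W \<Longrightarrow> f (v \<oplus>\<^bsub>V\<^esub> w) = g w"
    and U: "submodule K U V" "U \<subseteq> W" "\<forall>u\<in>U. g u = g \<zero>\<^bsub>V\<^esub>" and w: "w \<in> W"
  shows "\<exists>h. poly_fun d h \<and> (\<forall>u\<in>U. f (v \<oplus>\<^bsub>V\<^esub> w \<oplus>\<^bsub>V\<^esub> u) = h u)"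
proof (intro exI conjI ballI)
  interpret W: submodule K W V by fact
  note c = subsetD[OF W.subset]
  have g0: "g \<zero>\<^bsub>V\<^esub> \<in> carrier K" using poly_fun_closed[OF g] by simp
  show "poly_fun d (\<lambda>x. g \<zero>\<^bsub>V\<^esub> \<oplus> (g (x \<oplus>\<^bsub>V\<^esub> w) \<ominus> g x))"
    using g0 c[OF w] by (intro poly_fun.add poly_fun.const poly_fun_difference g)
  fix u assume u: "u \<in> U"
  have uw: "u \<in> W" "u \<in> carrier V" "w \<in> carrier V" using u U(2) w c by auto
  have gw: "g (u \<oplus>\<^bsub>V\<^esub> w) \<in> carrier K" using uw poly_fun_closed[OF g] by simp
  have "f (v \<oplus>\<^bsub>V\<^esub> w \<oplus>\<^bsub>V\<^esub> u) = f (v \<oplus>\<^bsub>V\<^esub> (u \<oplus>\<^bsub>V\<^esub> w))"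
    using v uw by (simp add: M.a_ac)
  also have "\<dots> = g (u \<oplus>\<^bsub>V\<^esub> w)" using f uw w by simp
  also have "\<dots> = g \<zero>\<^bsub>V\<^esub> \<oplus> (g (u \<oplus>\<^bsub>V\<^esub> w) \<ominus> g \<zero>\<^bsub>V\<^esub>)"
    using R.a_lcomm[OF g0 gw R.a_inv_closed[OF g0]] g0 gw by (simp add: a_minus_def R.r_neg)
  also have "g \<zero>\<^bsub>V\<^esub> = g u" using U(3) u by simp
  finally show "f (v \<oplus>\<^bsub>V\<^esub> w \<oplus>\<^bsub>V\<^esub> u) = g \<zero>\<^bsub>V\<^esub> \<oplus> (g (u \<oplus>\<^bsub>V\<^esub> w) \<ominus> g u)"
    using U(3) u by simp
qed

text \<open>Here \<open>m\<close> stands for the dimension of the space being partitioned. Bounding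
  \<open>m\<close> from above by a power of \<open>k + 1\<close> keeps the induction within natural
  numbers; roots are taken only at the end.\<close>

definition constant_parts :: "nat \<Rightarrow> nat \<Rightarrow> ('c \<Rightarrow> 'a) \<Rightarrow> 'c set set \<Rightarrow> bool" where
  "constant_parts e m f P \<longleftrightarrow>
     (\<forall>A\<in>P. \<exists>k u U. has_dim k U \<and> u \<in> carrier V \<and> A = coset u U \<and>
        m \<le> 8 ^ loss e * (k + 1) ^ fact e \<and> (\<exists>b\<in>carrier K. \<forall>x\<in>A. f x = b))"

text \<open>Induction on the degree: a constancy subspace of \<open>g\<close> cuts the coset into
  smaller cosets, on each of which \<open>f\<close> is described by its own function of lower
  degree. Therefore \<open>v\<close>, \<open>W\<close> and \<open>g\<close> vary while
  \<open>f\<close> stays fixed.\<close>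

lemma exists_partition_constant_parts:
  assumes "has_dim m W" "v \<in> carrier V" "poly_fun (Suc e) g" "\<And>w. w \<in> W \<Longrightarrow> f (v \<oplus>\<^bsub>V\<^esub> w) = g w"
  shows "\<exists>P. partition_on (coset v W) P \<and> constant_parts e m f P"
  using assms
proof (induction e arbitrary: m W v g)
  case 0
  note W = has_dim_submodule[OF 0(1)]
  \<comment> \<open>For degree 1 the binomial is \<open>1\<close>, so \<open>m - 1\<close> meets the
    threshold; for \<open>m = 0\<close> truncated subtraction gives the admissible dimension
    \<open>0\<close>.\<close>
  obtain U where U: "has_dim (m - 1) U" "U \<subseteq> W" "\<forall>u\<in>U. g u = g \<zero>\<^bsub>V\<^esub>"
    using exists_constant_subspace[OF 0(1,3), of "m - 1"] by fastforce
  note c = subsetD[OF has_dim_subset[OF 0(1)]] subsetD[OF has_dim_subset[OF U(1)]]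
  let ?P = "(\<lambda>w. coset (v \<oplus>\<^bsub>V\<^esub> w) U) ` W"
  have "\<exists>b\<in>carrier K. \<forall>x\<in>coset (v \<oplus>\<^bsub>V\<^esub> w) U. f x = b" if w: "w \<in> W" for w
  proof -
    obtain h where h: "poly_fun 0 h" "\<forall>u\<in>U. f (v \<oplus>\<^bsub>V\<^esub> w \<oplus>\<^bsub>V\<^esub> u) = h u"
      using poly_fun_on_coset[OF 0(3,2) W 0(4) has_dim_submodule[OF U(1)] U(2,3) w] by blast
    have "f x = h \<zero>\<^bsub>V\<^esub>" if "x \<in> coset (v \<oplus>\<^bsub>V\<^esub> w) U" for x
      using that h(2) poly_fun_zero_const[OF h(1) refl c(2) M.zero_closed] by auto
    then show ?thesis using poly_fun_closed[OF h(1)] by blast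
  qed
  note * = this
  have "constant_parts 0 m f ?P"
    unfolding constant_parts_def
  proof (intro ballI)
    fix A assume "A \<in> ?P"
    then obtain w where w: "w \<in> W" "A = coset (v \<oplus>\<^bsub>V\<^esub> w) U" by auto
    have "v \<oplus>\<^bsub>V\<^esub> w \<in> carrier V" using w 0(2) c by simp
    moreover have "m \<le> 8 ^ loss 0 * (m - 1 + 1) ^ fact 0" by simp
    ultimately show "\<exists>k u U. has_dim k U \<and> u \<in> carrier V \<and> A = coset u U \<and>
        m \<le> 8 ^ loss 0 * (k + 1) ^ fact 0 \<and> (\<exists>b\<in>carrier K. \<forall>x\<in>A. f x = b)"
      using U(1) w * by blast
  qed
  then show ?case
    using partition_on_cosets[OF has_dim_submodule[OF U(1)] W U(2) 0(2)] by blast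
next
  case (Suc e)
  note W = has_dim_submodule[OF Suc.prems(1)]
  obtain k where k: "k = 0 \<or> ((k + Suc (Suc e)) choose (k + 1)) + k \<le> m"
    and m: "m \<le> (4 * (k + 1)) ^ Suc e"
    using exists_subspace_dimension by blast
  obtain U where U: "has_dim k U" "U \<subseteq> W" "\<forall>u\<in>U. g u = g \<zero>\<^bsub>V\<^esub>"
    using exists_constant_subspace[OF Suc.prems(1,3) k] by blast
  note c = subsetD[OF has_dim_subset[OF Suc.prems(1)]]
  let ?P = "(\<lambda>w. coset (v \<oplus>\<^bsub>V\<^esub> w) U) ` W"
  have "\<exists>P. partition_on B P \<and> constant_parts e k f P" if B: "B \<in> ?P" for B
  proof -
    from B obtain w where w: "w \<in> W" "B = coset (v \<oplus>\<^bsub>V\<^esub> w) U" by auto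
    obtain h where h: "poly_fun (Suc e) h" "\<forall>u\<in>U. f (v \<oplus>\<^bsub>V\<^esub> w \<oplus>\<^bsub>V\<^esub> u) = h u"
      using poly_fun_on_coset[OF Suc.prems(3,2) W Suc.prems(4) has_dim_submodule[OF U(1)] U(2,3) w(1)]
      by blast
    show ?thesis
      unfolding w(2) using Suc.IH[OF U(1) _ h(1)] h(2) w(1) c Suc.prems(2) by auto
  qed
  then obtain R where R: "\<And>B. B \<in> ?P \<Longrightarrow> partition_on B (R B)"
    "\<And>B. B \<in> ?P \<Longrightarrow> constant_parts e k f (R B)" by metis
  have "m \<le> 8 ^ loss (Suc e) * (j + 1) ^ fact (Suc e)" if "k \<le> 8 ^ loss e * (j + 1) ^ fact e" for j
  proof -
    define N where "N = 8 ^ loss e * (j + 1) ^ fact e"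
    have "N \<ge> 1" "k \<le> N" using that by (auto simp: N_def)
    \<comment> \<open>\<open>k + 1 \<le> 2 * N\<close> because \<open>N \<ge> 1\<close>; this
      doubling turns the base \<open>4\<close> into \<open>8\<close>.\<close>
    then have "m \<le> (8 * N) ^ Suc e"
      using m power_mono[of "4 * (k + 1)" "8 * N" "Suc e"] by simp
    also have "\<dots> = 8 ^ loss (Suc e) * (j + 1) ^ fact (Suc e)"
    proof -
      have "loss (Suc e) = Suc e + loss e * Suc e" "fact (Suc e) = (fact e * Suc e :: nat)" by simp_all
      then show ?thesis
        unfolding N_def by (simp only: power_mult_distrib power_mult power_add mult.assoc)
    qed
    finally show ?thesis .
  qed
  note step = this
  have "constant_parts (Suc e) m f (\<Union>B\<in>?P. R B)"
    unfolding constant_parts_def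
  proof (intro ballI)
    fix A assume "A \<in> (\<Union>B\<in>?P. R B)"
    then obtain B where B: "B \<in> ?P" "A \<in> R B" by (elim UN_E)
    from bspec[OF R(2)[OF B(1), unfolded constant_parts_def] B(2)]
    obtain j u S where "has_dim j S" "u \<in> carrier V" "A = coset u S"
      "k \<le> 8 ^ loss e * (j + 1) ^ fact e" "\<exists>b\<in>carrier K. \<forall>x\<in>A. f x = b"
      by (elim exE conjE)
    then show "\<exists>k u U. has_dim k U \<and> u \<in> carrier V \<and> A = coset u U \<and>
        m \<le> 8 ^ loss (Suc e) * (k + 1) ^ fact (Suc e) \<and> (\<exists>b\<in>carrier K. \<forall>x\<in>A. f x = b)"
      using step by (intro exI[of _ j] exI[of _ u] exI[of _ S] conjI)
  qed
  moreover have "partition_on (coset v W) (\<Union>B\<in>?P. R B)"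
    by (rule partition_on_refine[OF partition_on_cosets[OF has_dim_submodule[OF U(1)] W U(2) Suc.prems(2)] R(1)])
  ultimately show ?case by (intro exI conjI)
qed

section \<open>Comparison of \<open>has_dim\<close> with the dimension of a vector space\<close>

lemma has_dim_carrier:
  assumes "card (carrier V) = q ^ n"
  shows "has_dim n (carrier V)"
proof -
  define Q where "Q k \<longleftrightarrow> (\<exists>U. has_dim k U)" for k
  have bound: "k \<le> n" if Qk: "Q k" for k
  proof -
    obtain U where U: "has_dim k U" using Qk by (auto simp: Q_def)
    have "q ^ k \<le> q ^ n"
      using card_mono[OF finite_V has_dim_subset[OF U]] has_dim_card[OF U] assms by simp
    then show ?thesis using q_ge_2 by (simp add: power_le_imp_le_exp)
  qed
  have "Q 0" using has_dim.zero by (auto simp: Q_def)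
  then obtain k where k: "Q k" and max: "\<And>j. Q j \<Longrightarrow> j \<le> k"
    using GreatestI_nat[of Q 0 n] Greatest_le_nat[of Q _ n] bound by blast
  obtain U where U: "has_dim k U" using k by (auto simp: Q_def)
  have "carrier V \<subseteq> U"
  proof
    fix x assume x: "x \<in> carrier V"
    \<comment> \<open>Adjoining a vector outside \<open>U\<close> would contradict the maximality of
      \<open>k\<close>. Once \<open>U\<close> is everything, cardinalities identify \<open>k\<close>
      with \<open>n\<close>.\<close>
    show "x \<in> U"
      using has_dim.adjoin[OF U x] max[of "Suc k"] by (auto simp: Q_def)
  qed
  then have eq: "U = carrier V" using has_dim_subset[OF U] by auto
  then have "q ^ k = q ^ n" using has_dim_card[OF U] assms by simp
  then have "k = n" using q_ge_2 by simp
  then show ?thesis using U eq by simp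
qed

text \<open>The adjoined vectors form a basis: a vector outside the span preserves independence, and
  the enlarged span is \<open>adjoin U x\<close>. This yields the dimension required by
  \<open>affine_subspace\<close>.\<close>

lemma has_dim_basis:
  "has_dim k U \<Longrightarrow> \<exists>B. finite B \<and> card B = k \<and> B \<subseteq> carrier V \<and> lin_indpt B \<and> span B = U"
proof (induction rule: has_dim.induct)
  case zero
  have "lin_indpt {}" by (auto simp: lin_dep_def)
  moreover have "span {} = {\<zero>\<^bsub>V\<^esub>}" by (auto simp: span_def lincomb_def)
  ultimately show ?case by (intro exI[of _ "{}"]) simp
next
  case (adjoin k U x)
  then obtain B where B: "finite B" "card B = k" "B \<subseteq> carrier V" "lin_indpt B" "span B = U" by blast
  have sub: "submodule K (span (B \<union> {x})) V"
    using B adjoin by (intro span_is_submodule) auto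
  have BU: "B \<subseteq> U" using in_own_span[OF B(3)] B by simp
  then have "x \<notin> B" using adjoin by auto
  have own: "B \<union> {x} \<subseteq> span (B \<union> {x})"
    using B adjoin by (intro in_own_span) auto
  have "lin_indpt (B \<union> {x})"
    using lin_dep_iff_in_span[OF B(3,4) adjoin.hyps(2) \<open>x \<notin> B\<close>] B adjoin by simp
  moreover have "span (B \<union> {x}) = adjoin U x"
  proof
    show "adjoin U x \<subseteq> span (B \<union> {x})"
      using own B span_is_monotone[of B "B \<union> {x}"] by (intro adjoin_subset[OF sub]) auto
    have "U \<subseteq> adjoin U x" "x \<in> adjoin U x"
    proof -
      show "U \<subseteq> adjoin U x"
      proof
        fix u assume "u \<in> U"
        then show "u \<in> adjoin U x"
          unfolding adjoin_iff using has_dim_subset[OF adjoin.hyps(1)] adjoin.hyps(2)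
          by (intro bexI[of _ u] bexI[of _ \<zero>]) auto
      qed
      show "x \<in> adjoin U x"
        unfolding adjoin_iff using submodule.zero_closed[OF has_dim_submodule[OF adjoin.hyps(1)]] adjoin.hyps(2)
        by (intro bexI[of _ "\<zero>\<^bsub>V\<^esub>"] bexI[of _ \<one>]) auto
    qed
    then show "span (B \<union> {x}) \<subseteq> adjoin U x"
      using BU submodule_adjoin[OF has_dim_submodule[OF adjoin.hyps(1)] adjoin.hyps(2)]
      by (intro span_is_subset) auto
  qed
  ultimately show ?case
    using B adjoin \<open>x \<notin> B\<close> by (intro exI[of _ "B \<union> {x}"]) auto
qed

lemma has_dim_subspace: "has_dim k U \<Longrightarrow> subspace K U V"
  using has_dim_submodule vectorspace_axioms by (simp add: subspace_def)

lemma has_dim_dim: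
  assumes "has_dim k U"
  shows "vectorspace.dim K (V\<lparr>carrier := U\<rparr>) = k"
proof -
  obtain B where B: "finite B" "card B = k" "B \<subseteq> carrier V" "lin_indpt B" "span B = U"
    using has_dim_basis[OF assms] by blast
  interpret U: vectorspace K "V\<lparr>carrier := U\<rparr>"
    by (rule subspace_is_vs[OF has_dim_subspace[OF assms]])
  have BU: "B \<subseteq> U" using in_own_span[OF B(3)] B by simp
  have "U.basis B"
    unfolding U.basis_def
    using span_li_not_depend[OF BU has_dim_submodule[OF assms]] B BU by simp
  then show ?thesis using U.dim_basis[OF B(1)] B(2) by simp
qed

end

subsection \<open>Reduced polynomials as polynomial functions\<close>

lemma sum_count_le_size: "(\<Sum>i<(n::nat). count m i) \<le> size m"
proof -
  have "(\<Sum>i<n. count m i) = (\<Sum>i\<in>{..<n} \<inter> set_mset m. count m i)"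
    by (rule sum.mono_neutral_right) (auto simp: not_in_iff)
  also have "\<dots> \<le> (\<Sum>i\<in>set_mset m. count m i)"
    by (rule sum_mono2) auto
  finally show ?thesis by (simp add: size_multiset_overloaded_eq)
qed

lemma finite_vectorspace_tuple_space:
  assumes "field F" "finite (carrier F)"
  shows "finite_vectorspace F (tuple_space F n)"
proof -
  interpret field F by fact
  have "module F (tuple_space F n)" by (rule func_space_is_module)
  moreover have "finite (carrier (tuple_space F n))"
    using assms(2) by (simp add: func_space_def finite_PiE)
  ultimately show ?thesis
    using assms by (simp add: finite_vectorspace_def finite_vectorspace_axioms_def vectorspace_def)
qed

text \<open>Coordinates are linear functionals on tuples, so the monomial \<open>m\<close> is a
  product of at most \<open>size m\<close> functionals. This leads from coordinates to the
  basis-free notion.\<close>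

lemma poly_fun_mpoly_eval:
  assumes F: "field F" "finite (carrier F)" and p: "reduced_mpoly F n p"
  shows "finite_vectorspace.poly_fun F (tuple_space F n) (mpoly_degree F p) (mpoly_eval F n p)"
proof -
  interpret finite_vectorspace F "tuple_space F n"
    by (rule finite_vectorspace_tuple_space[OF F])
  have coord: "functional (\<lambda>x. x i)" if "i < n" for i
    unfolding functional_def using that by (auto simp: func_space_def)
  have "poly_fun 1 (\<lambda>x. x i)" if i: "i < n" for i
  proof -
    have "poly_fun (Suc 0) (\<lambda>x. x i \<otimes>\<^bsub>F\<^esub> \<one>\<^bsub>F\<^esub>)"
      by (intro poly_fun.mult coord i poly_fun.const R.one_closed)
    then have "poly_fun (Suc 0) (\<lambda>x. x i)"
      by (rule poly_fun.ext) (use functional_closed[OF coord[OF i]] in simp)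
    then show ?thesis by simp
  qed
  then have pow: "poly_fun (count m i) (\<lambda>x. x i [^]\<^bsub>F\<^esub> count m i)" if "i < n" for i and m :: "nat multiset"
    using poly_fun_pow[of 1 "\<lambda>x. x i" "count m i"] that by simp
  have "carrier_coeff p"
    using p by (intro indexed_pset_in_carrier[of "carrier F" p "{..<n}"]) (auto simp: reduced_mpoly_def)
  then have pm: "p m \<in> carrier F" for m by (rule carrier_coeffE)
  have mon: "poly_fun (size m) (\<lambda>x. p m \<otimes>\<^bsub>F\<^esub> (\<Otimes>\<^bsub>F\<^esub>i\<in>{..<n}. x i [^]\<^bsub>F\<^esub> count m i))" for m
  proof (rule poly_fun_smult[OF pm poly_fun_mono[OF _ sum_count_le_size]])
    show "poly_fun (\<Sum>i<n. count m i) (\<lambda>x. \<Otimes>\<^bsub>F\<^esub>i\<in>{..<n}. x i [^]\<^bsub>F\<^esub> count m i)"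
      using pow by (intro poly_fun_finprod) auto
  qed
  show ?thesis
  proof (cases "finite (mpoly_support F p)")
    case True
    have "size m \<le> mpoly_degree F p" if "m \<in> mpoly_support F p" for m
      unfolding mpoly_degree_def using True that by (intro Max_ge) auto
    then show ?thesis
      unfolding mpoly_eval_def using True by (intro poly_fun_finsum poly_fun_mono[OF mon]) auto
  next
    \<comment> \<open>A sum over an infinite support has the default value zero, a polynomial
      function of every degree; this takes the place of an argument that the support is
      finite.\<close>
    case False
    then show ?thesis
      unfolding mpoly_eval_def by (simp add: R.add.finprod_infinite poly_fun.const)
  qed
qed

text \<open>Taking the \<open>fact e\<close>-th root turns \<open>8 ^ (3 * fact e)\<close> into
  \<open>512\<close>. The constant is half of \<open>1 / 512\<close>, so that the scaled root is
  strictly below \<open>k + 1\<close> and its floor is at most \<open>k\<close>.\<close>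

lemma floor_root_le:
  assumes "n \<le> 8 ^ loss e * (k + 1) ^ fact e"
  shows "int k \<ge> \<lfloor>1 / 1024 * real n powr (1 / fact e)\<rfloor>"
proof -
  have "n \<le> 8 ^ (3 * fact e) * (k + 1) ^ fact e"
    using loss_le[of e] by (intro order.trans[OF assms] mult_le_mono1 power_increasing) auto
  also have "\<dots> = (512 * (k + 1)) ^ fact e"
    by (simp only: power_mult power_mult_distrib) simp
  finally have "real n \<le> real (512 * (k + 1)) ^ fact e"
    by (metis of_nat_le_iff of_nat_power)
  then have "real n powr (1 / fact e) \<le> (real (512 * (k + 1)) ^ fact e) powr (1 / fact e)"
    by (intro powr_mono2) auto
  also have "\<dots> = real (512 * (k + 1)) powr (real (fact e) * (1 / fact e))"
    by (simp add: powr_realpow[symmetric] powr_powr del: of_nat_fact)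
  also have "\<dots> = real (512 * (k + 1))" by simp
  finally have "1 / 1024 * real n powr (1 / fact e) < real k + 1" by simp
  then show ?thesis by (simp add: floor_le_iff)
qed

theorem theorem2:
  "\<exists>c::real. c > 0 \<and>
     (\<forall>(F :: nat ring) (n::nat) (d::nat) (f :: (nat \<Rightarrow> nat) \<Rightarrow> nat).
        field F \<and> finite (carrier F) \<and> d \<ge> 1 \<and>
        f \<in> carrier (tuple_space F n) \<rightarrow> carrier F \<and> has_degree F n f d \<longrightarrow>
        (\<exists>P. partition_on (carrier (tuple_space F n)) P \<and>
           (\<forall>A\<in>P. \<exists>k. affine_subspace F n k A \<and>
              int k \<ge> \<lfloor>c * real n powr (1 / fact (d - 1))\<rfloor> \<and>
              (\<exists>b\<in>carrier F. \<forall>x\<in>A. f x = b))))"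
proof (intro exI[of _ "1 / 1024"] conjI allI impI)
  fix F :: "nat ring" and n d :: nat and f :: "(nat \<Rightarrow> nat) \<Rightarrow> nat"
  assume *: "field F \<and> finite (carrier F) \<and> d \<ge> 1 \<and>
    f \<in> carrier (tuple_space F n) \<rightarrow> carrier F \<and> has_degree F n f d"
  then have F: "field F" "finite (carrier F)" by auto
  define V where "V = tuple_space F n"
  interpret finite_vectorspace F V
    unfolding V_def by (rule finite_vectorspace_tuple_space[OF F])
  \<comment> \<open>The induction parameter is one less than the degree, whence the factorial of
    \<open>d - 1\<close>.\<close>
  obtain e where d: "d = Suc e" using * by (cases d) auto
  obtain p where p: "reduced_mpoly F n p" "\<forall>x\<in>carrier V. f x = mpoly_eval F n p x" "mpoly_degree F p = d"
    using * by (auto simp: has_degree_def V_def)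
  have g: "poly_fun (Suc e) (mpoly_eval F n p)"
    using poly_fun_mpoly_eval[OF F p(1)] p(3) d V_def by simp
  have "card (carrier V) = q ^ n"
    by (simp add: V_def func_space_def card_PiE)
  then have W: "has_dim n (carrier V)" by (rule has_dim_carrier)
  have "f (\<zero>\<^bsub>V\<^esub> \<oplus>\<^bsub>V\<^esub> x) = mpoly_eval F n p x" if "x \<in> carrier V" for x
    using p(2) that by simp
  \<comment> \<open>The induction starts from the whole space, seen as the coset of itself through
    zero.\<close>
  from exists_partition_constant_parts[OF W M.zero_closed g this]
  obtain P where P: "partition_on (coset \<zero>\<^bsub>V\<^esub> (carrier V)) P" "constant_parts e n f P"
    by blast
  have "coset \<zero>\<^bsub>V\<^esub> (carrier V) = carrier V" by force
  then have "partition_on (carrier V) P" using P(1) by simp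
  moreover have "\<exists>k. affine_subspace F n k A \<and>
      int k \<ge> \<lfloor>1 / 1024 * real n powr (1 / fact (d - 1))\<rfloor> \<and> (\<exists>b\<in>carrier F. \<forall>x\<in>A. f x = b)"
    if A: "A \<in> P" for A
  proof -
    from bspec[OF P(2)[unfolded constant_parts_def] A]
    obtain k u U where U: "has_dim k U" and u: "u \<in> carrier V" and Au: "A = coset u U"
      and k: "n \<le> 8 ^ loss e * (k + 1) ^ fact e" and f: "\<exists>b\<in>carrier F. \<forall>x\<in>A. f x = b"
      by (elim exE conjE)
    have "A = u <+\<^bsub>V\<^esub> U" by (auto simp: Au a_l_coset_def')
    then have "affine_subspace F n k A"
      using u has_dim_subspace[OF U] has_dim_dim[OF U]
      unfolding affine_subspace_def V_def[symmetric] by blast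
    then show ?thesis using floor_root_le[OF k] f d by auto
  qed
  ultimately show "\<exists>P. partition_on (carrier (tuple_space F n)) P \<and>
      (\<forall>A\<in>P. \<exists>k. affine_subspace F n k A \<and>
         int k \<ge> \<lfloor>1 / 1024 * real n powr (1 / fact (d - 1))\<rfloor> \<and>
         (\<exists>b\<in>carrier F. \<forall>x\<in>A. f x = b))"
    unfolding V_def[symmetric] by blast
qed simp

end
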